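(* For each number of buyers $n\ge 1$ and each prior mean $p\in(0,1)$ there exists a pair $(k_s,x_s)\in[0,1]^2$ (depending on $p$ and $n$) such that the unique symmetric seller-worst information structure, i.e. the unique maximizer of $V_0(G)$ over $G\in\mathcal G_H$, is the truncated Pareto distribution $$G_s(x)=\begin{cases}0,& x\in[0,x_s);\\ 1-\dfrac{x_s-k_s}{x-k_s},& x\in[x_s,1);\\ 1,& x=1.\end{cases}$$ Moreover, for each $n$ there exists a threshold $p_s$ (depending only on $n$) such that (i) $k_s=0$ if $p\in(0,p_s]$; and (ii) $k_s>0$ if $p\in(p_s,1)$.
   Context: There are $n$ buyers, $N=\{1,\dots,n\}$, and one object. Buyers' valuations are i.i.d. Bernoulli on $\{0,1\}$ with mean $p\in(0,1)$. A feasible symmetric information structure is a CDF $G$ on $[0,1]$ (right-continuous) with $\int_0^1 x\,\mathrm dG(x)=p$ (equivalently $\int_0^1(1-G(x))\,\mathrm dx=p$); the set of these is $\mathcal G_H$. Each buyer $i$ receives an independent signal $x_i\sim G$. Ironed virtual value. For a CDF $G$ on $[0,1]$ let $a=\inf\{x\in[0,1]: G(x)>0\}$; $\Psi(x|G)=0$ for $x\in[0,a)$ and $\Psi(x|G)=a-x(1-G(x))$ for $x\in[a,1]$. Let $\Theta=\{(\beta_0,\beta_1)\in\mathbb R^2:\beta_0+\beta_1G(x)\le\Psi(x|G)\ \forall x\in[0,1]\}$ and $\Phi(x|G)=\sup\{\beta_0+\beta_1G(x):(\beta_0,\beta_1)\in\Theta\}$. A number $w$ is a sub-gradient of $\Phi(\cdot|G)$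 at $x$ if $\Phi(z|G)-\Phi(x|G)\ge w\,(G(z)-G(x))$ for all $z\in[0,1]$. The ironed virtual value $\hat\varphi(x|G)$ is the infimum (possibly $-\infty$) of the set of sub-gradients at $x$. Allocation. For a signal profile $x=(x_1,\dots,x_n)$ let $M(x|G)=\{i\in N:\hat\varphi(x_i|G)\ge\max_j\{\hat\varphi(x_j|G),0\}\}$ and $M'(x|G)=\{i\in M(x|G): x_i\ge x_j\ \forall j\in M(x|G)\}$. Put $q_i(x|G)=1/|M'(x|G)|$ if $i\in M'(x|G)$ and $q_i(x|G)=0$ otherwise. Objective. For $\alpha\in\{0,1\}$, $$V_\alpha(G)=\int_{[0,1]^n}\sum_{i=1}^n\big(\alpha x_i-\hat\varphi(x_i|G)\big)q_i(x|G)\prod_{i=1}^n\mathrm dG(x_i)$$ (terms with $q_i=0$ are $0$). A symmetric seller-worst information structure is a maximizer of $V_0$ over $\mathcal G_H$ (it minimizes the seller's optimal-auction revenue). *)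

theory Defs
  imports "HOL-Probability.Probability"
begin

(* A CDF on [0,1] is a function on the whole real line that is 0 on the left of 0 and 1 from 1 on;
   so interval_measure G puts an atom of mass G 0 at 0, and functions agreeing on [0,1] are equal. *)
definition cdf01 :: "(real \<Rightarrow> real) \<Rightarrow> bool" where
  "cdf01 G \<longleftrightarrow> mono G \<and> (\<forall>x. continuous (at_right x) G) \<and>
     (\<forall>x<0. G x = 0) \<and> (\<forall>x\<ge>1. G x = 1)"

definition feasible :: "real \<Rightarrow> (real \<Rightarrow> real) \<Rightarrow> bool" where
  "feasible p G \<longleftrightarrow> cdf01 G \<and> (LINT x:{0..1}|interval_measure G. x) = p"

definition lower_end :: "(real \<Rightarrow> real) \<Rightarrow> real" where
  "lower_end G = Inf {x \<in> {0..1}. G x > 0}"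

definition Psi :: "(real \<Rightarrow> real) \<Rightarrow> real \<Rightarrow> real" where
  "Psi G x = (if x < lower_end G then 0 else lower_end G - x * (1 - G x))"

definition affine_minorants :: "(real \<Rightarrow> real) \<Rightarrow> (real \<times> real) set" where
  "affine_minorants G = {(b0, b1). \<forall>x\<in>{0..1}. b0 + b1 * G x \<le> Psi G x}"

(* For a CDF on [0,1] this is the supremum of a nonempty set ((lower_end G - 1, 1) is a minorant)
   that is bounded above by Psi G x, for x in [0,1]. *)
definition Phi :: "(real \<Rightarrow> real) \<Rightarrow> real \<Rightarrow> real" where
  "Phi G x = (SUP (b0, b1) \<in> affine_minorants G. b0 + b1 * G x)"

definition subgradients :: "(real \<Rightarrow> real) \<Rightarrow> real \<Rightarrow> real set" where
  "subgradients G x = {w. \<forall>z\<in>{0..1}. Phi G z - Phi G x \<ge> w * (G z - G x)}"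

(* Where G x is the least value of G on [0,1], the set of sub-gradients is unbounded below, or empty
   if Phi has slope - infinity there. The value is - infinity in both cases; without the case
   distinction Inf {} would make it + infinity in the second. *)
definition ironed_vv :: "(real \<Rightarrow> real) \<Rightarrow> real \<Rightarrow> ereal" where
  "ironed_vv G x =
     (if subgradients G x = {} then - \<infinity> else (INF w \<in> subgradients G x. ereal w))"

definition winners :: "nat \<Rightarrow> (real \<Rightarrow> real) \<Rightarrow> (nat \<Rightarrow> real) \<Rightarrow> nat set" where
  "winners n G x =
     {i \<in> {1..n}. ironed_vv G (x i) \<ge> Max ((\<lambda>j. max (ironed_vv G (x j)) 0) ` {1..n})}"

definition top_winners :: "nat \<Rightarrow> (real \<Rightarrow> real) \<Rightarrow> (nat \<Rightarrow> real) \<Rightarrow> nat set" where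
  "top_winners n G x = {i \<in> winners n G x. \<forall>j \<in> winners n G x. x i \<ge> x j}"

definition alloc :: "nat \<Rightarrow> (real \<Rightarrow> real) \<Rightarrow> (nat \<Rightarrow> real) \<Rightarrow> nat \<Rightarrow> real" where
  "alloc n G x i =
     (if i \<in> top_winners n G x then 1 / real (card (top_winners n G x)) else 0)"

(* real_of_ereal loses nothing: for feasible G with mean in (0,1) and signals in [0,1], an object is
   allocated only at ironed virtual values in [0,1]. In particular the integrand is bounded. *)
definition V :: "nat \<Rightarrow> real \<Rightarrow> (real \<Rightarrow> real) \<Rightarrow> real" where
  "V n \<alpha> G =
     (LINT x : ({1..n} \<rightarrow>\<^sub>E {0..1}) | (\<Pi>\<^sub>M i\<in>{1..n}. interval_measure G).
        (\<Sum>i=1..n. (\<alpha> * x i - real_of_ereal (ironed_vv G (x i))) * alloc n G x i))"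

definition seller_worst :: "nat \<Rightarrow> real \<Rightarrow> (real \<Rightarrow> real) \<Rightarrow> bool" where
  "seller_worst n p G \<longleftrightarrow> is_arg_max (V n 0) (feasible p) G"

definition trunc_pareto :: "real \<Rightarrow> real \<Rightarrow> real \<Rightarrow> real" where
  "trunc_pareto k s x = (if x < s then 0 else if x < 1 then 1 - (s - k) / (x - k) else 1)"

end

theory Submission
  imports Defs "HOL-Real_Asymp.Real_Asymp"
begin

text \<open>
  Only the positive part of the ironed virtual value of a buyer matters. In quantile space let \<open>f\<close> be
  this positive part, a nondecreasing function on \<open>(0, 1)\<close> with values in \<open>[0, 1]\<close>, and let \<open>H t\<close> be the
  measure of \<open>{f \<le> t}\<close>. Then \<open>V 0 = \<integral> H\<^sup>n - 1\<close>. Since \<open>f\<close> is the slope of a concave majorant of the revenue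
  curve, the quantile function \<open>Q\<close> of a signal distribution obeys \<open>(1 - q) Q(q) \<le> \<integral>\<^sub>q\<^sup>1 f\<close>; integrating
  over \<open>q\<close> gives \<open>p \<le> 1 - \<integral> D(H)\<close> with \<open>D(h) = h + (1 - h) ln (1 - h)\<close>. So the problem becomes to
  maximize \<open>\<integral> H\<^sup>n\<close> subject to \<open>\<integral> D(H) \<le> 1 - p\<close>, \<open>0 \<le> H \<le> 1\<close>, and a pointwise Lagrangian bound
  \<open>h\<^sup>n \<le> l D(h) + v\<close>, tight only at \<open>0\<close> and at one \<open>q\<close>, solves it: the maximizers take only the values
  \<open>0\<close> and \<open>q\<close>, which forces equality throughout and hence determines \<open>Q\<close>. The value \<open>q\<close> is the larger of the
  minimizer of \<open>D(h) / h\<^sup>n\<close> (giving \<open>k > 0\<close>) and the solution of \<open>D(q) = 1 - p\<close> (giving \<open>k = 0\<close>).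
\<close>

section \<open>The Lagrangian of the reduced problem\<close>

text \<open>The antiderivative of \<open>- ln (1 - t)\<close> vanishing at 0. By
  \<open>integral_min_ratio\<close>, \<open>1 - mean_gap q\<close> is the mean of the truncated
  Pareto law with \<open>k = 0\<close> and mass \<open>q\<close> below its atom at 1.\<close>

definition mean_gap :: "real \<Rightarrow> real" where
  "mean_gap q = q + (1 - q) * ln (1 - q)"

lemma mean_gap_0 [simp]: "mean_gap 0 = 0" and mean_gap_1 [simp]: "mean_gap 1 = 1"
  by (simp_all add: mean_gap_def)

lemma has_real_derivative_mean_gap:
  "t < 1 \<Longrightarrow> (mean_gap has_real_derivative - ln (1 - t)) (at t)"
  unfolding mean_gap_def by (auto intro!: derivative_eq_intros)

lemma continuous_on_mean_gap: "continuous_on {0..1} mean_gap"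
proof -
  have "continuous (at t within {0..1}) mean_gap" if "t \<in> {0..1}" for t
  proof (cases "t = 1")
    case True
    have "((\<lambda>q. q + (1 - q) * ln (1 - q)) \<longlongrightarrow> (1::real)) (at_left 1)"
      by real_asymp
    then have "(mean_gap \<longlongrightarrow> mean_gap 1) (at_left 1)"
      by (simp add: mean_gap_def[abs_def])
    moreover have "at_left (1::real) = at 1 within {0..1}"
      by (rule at_within_nhd[of _ "{0<..}"]) auto
    ultimately show ?thesis
      using True by (simp add: continuous_within)
  next
    case False
    with that have "isCont mean_gap t"
      by (intro DERIV_isCont[OF has_real_derivative_mean_gap]) auto
    then show ?thesis by (rule continuous_at_imp_continuous_at_within)
  qed
  then show ?thesis by (simp add: continuous_on_eq_continuous_within)
qed

lemma mean_gap_strict_mono: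
  assumes "0 \<le> x" "x < y" "y \<le> 1" shows "mean_gap x < mean_gap y"
proof (rule DERIV_pos_imp_increasing_open[OF \<open>x < y\<close>])
  fix t assume "x < t" "t < y"
  with assms show "\<exists>z. (mean_gap has_real_derivative z) (at t) \<and> 0 < z"
    by (intro exI[of _ "- ln (1 - t)"] conjI has_real_derivative_mean_gap) auto
next
  show "continuous_on {x..y} mean_gap"
    using assms by (intro continuous_on_subset[OF continuous_on_mean_gap]) auto
qed

lemma mean_gap_bounds: "x \<in> {0..1} \<Longrightarrow> 0 \<le> mean_gap x \<and> mean_gap x \<le> 1"
  using mean_gap_strict_mono[of 0 x] mean_gap_strict_mono[of x 1]
  by (cases "x = 0"; cases "x = 1") auto

lemma mean_gap_pos: "0 < x \<Longrightarrow> x \<le> 1 \<Longrightarrow> 0 < mean_gap x"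
  using mean_gap_strict_mono[of 0 x] by auto

text \<open>The derivative of \<open>mean_gap q / q ^ n\<close> is
  \<open>- excess n q / q ^ (n + 1)\<close>, so the zeros in (0, 1) are the critical points of that
  ratio.\<close>

definition excess :: "nat \<Rightarrow> real \<Rightarrow> real" where
  "excess n q = n * mean_gap q + q * ln (1 - q)"

lemma has_real_derivative_excess:
  "t < 1 \<Longrightarrow> (excess n has_real_derivative - (real n - 1) * ln (1 - t) - t / (1 - t)) (at t)"
  unfolding excess_def
  by (auto intro!: derivative_eq_intros has_real_derivative_mean_gap simp: field_simps)

text \<open>The derivative has the sign of \<open>ln (1 - t) + t\<close>, which is negative. This
  quotient, times \<open>n - 1\<close> and compared with 1, decides the sign of the slope of
  \<open>excess n\<close>.\<close>

lemma log_ratio_strict_antimono: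
  assumes "0 < x" "x < y" "y < (1::real)"
  shows "- (1 - y) * ln (1 - y) / y < - (1 - x) * ln (1 - x) / x"
proof (rule DERIV_neg_imp_decreasing[OF \<open>x < y\<close>])
  fix t assume t: "x \<le> t" "t \<le> y"
  have "ln (1 - t) < - t"
    using ln_less_self t assms ln_add_one_self_le_self2[of "-t"] ln_eq_minus_one[of "1-t"]
    by fastforce
  then have "(ln (1 - t) + t) / t\<^sup>2 < 0"
    using t assms by (intro divide_neg_pos) auto
  moreover have "((\<lambda>t. - (1 - t) * ln (1 - t) / t) has_real_derivative (ln (1 - t) + t) / t\<^sup>2) (at t)"
    using t assms by (auto intro!: derivative_eq_intros simp: field_simps power2_eq_square)
  ultimately show "\<exists>z. ((\<lambda>t. - (1 - t) * ln (1 - t) / t) has_real_derivative z) (at t) \<and> z < 0"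
    by blast
qed

text \<open>The slope of \<^term>\<open>excess n\<close> has the sign of a decreasing function, and \<^term>\<open>excess n 0 = 0\<close>;
  so once the excess is nonpositive it keeps decreasing.\<close>

lemma excess_slope_neg:
  assumes h: "0 < h" "excess n h \<le> 0" and t: "h \<le> t" "t < 1"
  shows "- (real n - 1) * ln (1 - t) - t / (1 - t) < 0"
proof -
  define s where "s t = - (1 - t) * ln (1 - t) / t" for t :: real
  have sign: "- (real n - 1) * ln (1 - t) - t / (1 - t) = t / (1 - t) * ((real n - 1) * s t - 1)"
    if "0 < t" "t < 1" for t
    using that by (simp add: s_def field_simps)
  have anti: "s y \<le> s x" if "0 < x" "x \<le> y" "y < 1" for x y
    using log_ratio_strict_antimono[of x y] that by (cases "x = y") (auto simp: s_def)
  have anti': "s y < s x" if "0 < x" "x < y" "y < 1" for x y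
    using log_ratio_strict_antimono[of x y] that by (auto simp: s_def)
  \<comment> \<open>Otherwise, as \<open>s\<close> decreases, the slope of \<open>excess n\<close>
    would be positive on all of (0, h) and \<open>excess n h\<close> would be positive.\<close>
  have n1: "(real n - 1) * s h < 1"
  proof (rule ccontr)
    assume neg: "\<not> ?thesis"
    have "0 < s h"
      unfolding s_def using t h by (intro divide_pos_pos) (auto intro: mult_neg_neg)
    with neg have n: "real n - 1 > 0"
      by (smt (verit) mult_nonneg_nonneg mult_le_0_iff)
    have "excess n 0 < excess n h"
    proof (rule DERIV_pos_imp_increasing_open[OF \<open>0 < h\<close>])
      fix t' assume t': "0 < t'" "t' < h"
      have "(real n - 1) * s h < (real n - 1) * s t'"
        using anti'[of t' h] t t' n by auto
      then have "t' / (1 - t') * ((real n - 1) * s t' - 1) > 0"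
        using neg t t' by (intro mult_pos_pos) auto
      then show "\<exists>y. (excess n has_real_derivative y) (at t') \<and> 0 < y"
        using has_real_derivative_excess[of t' n] sign[of t'] t' t by auto
    next
      show "continuous_on {0..h} (excess n)"
        using t by (intro continuous_at_imp_continuous_on ballI DERIV_isCont[OF has_real_derivative_excess]) auto
    qed
    with h show False by (simp add: excess_def)
  qed
  have "(real n - 1) * s t < 1"
  proof (cases "real n - 1 \<ge> 0")
    case True
    then have "(real n - 1) * s t \<le> (real n - 1) * s h"
      using anti[of h t] h t by (intro mult_left_mono) auto
    with n1 show ?thesis by simp
  next
    \<comment> \<open>Here \<open>n = 0\<close>, and the product is negative.\<close>
    case False
    have "0 < s t"
      unfolding s_def using t h by (intro divide_pos_pos) (auto intro: mult_neg_neg)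
    with False show ?thesis by (smt (verit) mult_neg_pos)
  qed
  then show ?thesis
    unfolding sign[OF less_le_trans[OF h(1) t(1)] t(2)]
    using h t by (intro mult_pos_neg) auto
qed

lemma excess_strict_antimono:
  assumes h: "0 < h" "excess n h \<le> 0" and t: "h < t" "t < 1"
  shows "excess n t < excess n h"
proof (rule DERIV_neg_imp_decreasing[OF t(1)])
  fix x assume "h \<le> x" "x \<le> t"
  then show "\<exists>y. (excess n has_real_derivative y) (at x) \<and> y < 0"
    using excess_slope_neg[OF h, of x] has_real_derivative_excess[of x n] t by auto
qed

text \<open>Up to the factor \<open>n\<close>, \<open>- ln (1 - t) / t ^ (n - 1)\<close> is the
  reciprocal of the multiplier \<open>l\<close> that makes \<open>t\<close> a critical point of
  \<open>t ^ n - l * mean_gap t\<close>. The derivative of its logarithm \<open>r\<close> has the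
  sign opposite to the slope of \<open>excess n\<close>. Denominators are cleared in the
  statement.\<close>

lemma marginal_ratio_strict_mono:
  assumes n: "n \<ge> 1" and h: "0 < h" "excess n h \<le> 0" and t: "h < t" "t < 1"
  shows "h ^ (n - 1) * ln (1 - t) < t ^ (n - 1) * ln (1 - h)"
proof -
  define r where "r t = ln (- ln (1 - t)) - (real n - 1) * ln t" for t :: real
  have "r h < r t"
  proof (rule DERIV_pos_imp_increasing[OF t(1)])
    fix x assume x: "h \<le> x" "x \<le> t"
    have l: "ln (1 - x) < 0" using x h t by auto
    have "(r has_real_derivative 1 / ((1 - x) * (- ln (1 - x))) - (real n - 1) / x) (at x)"
      unfolding r_def using x h t l by (auto intro!: derivative_eq_intros simp: field_simps)
    moreover have "0 < (x / (1 - x) + (real n - 1) * ln (1 - x)) / (x * - ln (1 - x))"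
      using excess_slope_neg[OF h, of x] x t h l
      by (intro divide_pos_pos mult_pos_pos) (auto simp: algebra_simps)
    moreover have "(x / (1 - x) + (real n - 1) * ln (1 - x)) / (x * - ln (1 - x))
       = 1 / ((1 - x) * (- ln (1 - x))) - (real n - 1) / x"
      using x h t l by (simp add: field_simps)
    ultimately show "\<exists>y. (r has_real_derivative y) (at x) \<and> 0 < y" by auto
  qed
  moreover have "ln (- ln (1 - x) / x ^ (n - 1)) = r x" if "0 < x" "x < 1" for x
    using that n ln_div[of "- ln (1 - x)" "x ^ (n - 1)"]
    by (simp add: r_def ln_realpow of_nat_diff)
  moreover have "0 < - ln (1 - x) / x ^ (n - 1)" if "0 < x" "x < 1" for x :: real
    using that by (intro divide_pos_pos) auto
  ultimately have "- ln (1 - h) / h ^ (n - 1) < - ln (1 - t) / t ^ (n - 1)"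
    using h t by (smt (verit) ln_less_cancel_iff)
  then show ?thesis
    using h t by (simp add: field_simps)
qed

text \<open>The choice of \<open>l\<close> makes \<open>q\<close> critical. To the right of
  \<open>q\<close> the function \<open>W\<close> strictly decreases. To the left, an interior
  maximizer would be critical with a negative value, whereas \<open>W 0 = 0\<close> and
  \<open>W q \<ge> 0\<close>.\<close>

lemma lagrangian_maximum:
  fixes q :: real
  assumes n: "n \<ge> 1" and q: "0 < q" "q < 1" "excess n q \<le> 0"
  defines "l \<equiv> n * q ^ (n - 1) / - ln (1 - q)"
  assumes h: "0 \<le> h" "h \<le> 1"
  shows "h ^ n - l * mean_gap h \<le> q ^ n - l * mean_gap q" (is "?W h \<le> ?W q")
    and "h ^ n - l * mean_gap h = q ^ n - l * mean_gap q \<Longrightarrow> h = 0 \<or> h = q"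
proof -
  define W where "W x = x ^ n - l * mean_gap x" for x
  have lq: "ln (1 - q) < 0" using q by auto
  have l: "l > 0" unfolding l_def using n q by (intro divide_pos_pos mult_pos_pos) auto
  have dW: "(W has_real_derivative n * x ^ (n - 1) + l * ln (1 - x)) (at x)" if "x < 1" for x :: real
    unfolding W_def
    using that by (auto intro!: derivative_eq_intros has_real_derivative_mean_gap)
  have dW': "n * x ^ (n - 1) + l * ln (1 - x)
      = n / - ln (1 - q) * (q ^ (n - 1) * ln (1 - x) - x ^ (n - 1) * ln (1 - q))" for x :: real
    using lq unfolding l_def by (simp add: field_simps)
  have cont: "continuous_on {0..1} W"
    unfolding W_def by (intro continuous_intros continuous_on_mean_gap)
  have pow: "x ^ n = x * x ^ (n - 1)" for x :: real
    using n by (cases n) auto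
  have Wq: "W q = - (q ^ (n - 1) / - ln (1 - q) * excess n q)"
    unfolding W_def l_def excess_def pow using lq by (simp add: field_simps)
  have "W q \<ge> 0"
    unfolding Wq using q lq by (simp add: mult_nonneg_nonpos zero_le_divide_iff)
  have right: "W h < W q" if h: "q < h" "h \<le> 1" for h
  proof (rule DERIV_neg_imp_decreasing_open[OF h(1)])
    fix x assume x: "q < x" "x < h"
    have "q ^ (n - 1) * ln (1 - x) < x ^ (n - 1) * ln (1 - q)"
      using marginal_ratio_strict_mono[OF n q(1,3), of x] x h by auto
    then have "n / - ln (1 - q) * (q ^ (n - 1) * ln (1 - x) - x ^ (n - 1) * ln (1 - q)) < 0"
      using n lq by (intro mult_pos_neg divide_pos_pos) auto
    then have "n * x ^ (n - 1) + l * ln (1 - x) < 0"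
      using dW'[of x] by simp
    then show "\<exists>y. (W has_real_derivative y) (at x) \<and> y < 0"
      using dW[of x] x h by auto
  next
    show "continuous_on {q..h} W"
      using h q by (intro continuous_on_subset[OF cont]) auto
  qed
  text \<open>At a critical point \<^term>\<open>x < q\<close> the multiplier of \<^term>\<open>x\<close> is again \<^term>\<open>l\<close>, so
    \<^term>\<open>W x \<ge> 0\<close> would give a nonpositive excess at \<^term>\<open>x\<close>, where the multiplier is injective.\<close>
  have crit: "W x < 0" if x: "0 < x" "x < q" and "(W has_real_derivative 0) (at x)" for x
  proof -
    have "n * x ^ (n - 1) + l * ln (1 - x) = 0"
      using DERIV_unique[OF that(3) dW[of x]] x q by simp
    moreover have lx: "ln (1 - x) < 0" using x q by auto
    ultimately have lx': "l = n * x ^ (n - 1) / - ln (1 - x)"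
      by (simp add: field_simps)
    have eq: "q ^ (n - 1) * ln (1 - x) = x ^ (n - 1) * ln (1 - q)"
      using \<open>n * x ^ (n - 1) + l * ln (1 - x) = 0\<close> n lq unfolding dW' by auto
    have Wx: "W x = - (x ^ (n - 1) / - ln (1 - x) * excess n x)"
      unfolding W_def lx' excess_def pow using lx by (simp add: field_simps)
    have "\<not> excess n x \<le> 0"
      using marginal_ratio_strict_mono[OF n x(1) _ x(2) q(2)] eq by (auto simp: mult.commute)
    then have "x ^ (n - 1) / - ln (1 - x) * excess n x > 0"
      using x lx by (intro mult_pos_pos divide_pos_pos) auto
    then show ?thesis
      unfolding Wx by simp
  qed
  have left: "W h \<le> W q \<and> (W h = W q \<longrightarrow> h = 0 \<or> h = q)" if h: "0 \<le> h" "h \<le> q" for h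
  proof -
    have "continuous_on {0..q} W"
      using q by (intro continuous_on_subset[OF cont]) auto
    then obtain m where m: "m \<in> {0..q}" and max: "\<And>y. y \<in> {0..q} \<Longrightarrow> W y \<le> W m"
      using continuous_attains_sup[of "{0..q}" W] q by auto
    \<comment> \<open>Stated for an arbitrary maximizer on \<open>{0..q}\<close>: applied to
      \<open>m\<close> it gives the inequality, applied to \<open>h\<close> the equality
      case.\<close>
    have max0: "x = 0 \<or> x = q" if x: "x \<in> {0..q}" and mx: "\<And>y. y \<in> {0..q} \<Longrightarrow> W y \<le> W x" for x
    proof (rule ccontr)
      assume "\<not> ?thesis"
      with x have x': "0 < x" "x < q" by auto
      have "n * x ^ (n - 1) + l * ln (1 - x) = 0"
        by (rule DERIV_local_max[OF dW, of x "min x (q - x)"])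
           (use x' q in \<open>auto simp: abs_real_def intro!: mx split: if_splits\<close>)
      then have "W x < 0"
        using crit[OF x'] dW[of x] x' q by auto
      with mx[of q] \<open>W q \<ge> 0\<close> q show False by auto
    qed
    have "W m \<le> W q"
      using max0[OF m max] n \<open>W q \<ge> 0\<close> by (auto simp: W_def power_0_left)
    moreover from this have "W h = W q \<Longrightarrow> h = 0 \<or> h = q"
      using max0[of h] max h by force
    ultimately show ?thesis using max[of h] h by auto
  qed
  show "?W h \<le> ?W q" and "?W h = ?W q \<Longrightarrow> h = 0 \<or> h = q"
    using left[of h] right[of h] h unfolding W_def by (cases "h \<le> q"; force)+
qed

section \<open>Existence of the multipliers and the threshold for the prior mean\<close>

lemma excess_neg_near_1:
  assumes "n \<ge> 1" defines "t \<equiv> 1 - exp (- real n)"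
  shows "0 < t" "t < 1" "excess n t < 0"
proof -
  show t: "0 < t" "t < 1" using assms by (auto simp: t_def)
  \<comment> \<open>The choice of \<open>t\<close> makes \<open>ln (1 - t) = - n\<close>.\<close>
  have "excess n t = - (real n)\<^sup>2 * (1 - t)"
    by (simp add: excess_def mean_gap_def t_def algebra_simps power2_eq_square)
  also have "\<dots> < 0" using t assms by (intro mult_neg_pos) auto
  finally show "excess n t < 0" .
qed

text \<open>A certificate of optimality for the function \<open>H\<close> that is 0 with weight
  \<open>k\<close> and \<open>q\<close> with weight \<open>1 - k\<close>: \<open>l\<close> is the
  multiplier of the mean constraint, \<open>v\<close> that of the total weight 1. For
  \<open>n \<ge> 1\<close> the bound at \<open>h = 0\<close> reads \<open>0 \<le> v\<close>, so
  \<open>v * k = 0\<close> is complementary slackness.\<close>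

definition pareto_multipliers :: "nat \<Rightarrow> real \<Rightarrow> real \<Rightarrow> real \<Rightarrow> real \<Rightarrow> real \<Rightarrow> bool" where
  "pareto_multipliers n p q k l v \<longleftrightarrow> 0 < q \<and> q < 1 \<and> 0 \<le> k \<and> k < 1 \<and>
     (1 - k) * mean_gap q = 1 - p \<and> 0 < l \<and> v * k = 0 \<and> q ^ n = l * mean_gap q + v \<and>
     (\<forall>h\<in>{0..1}. h ^ n \<le> l * mean_gap h + v \<and> (h ^ n = l * mean_gap h + v \<longrightarrow> h = 0 \<or> h = q))"

text \<open>\<open>l\<close> makes \<open>q\<close> critical and \<open>v\<close> makes the bound
  tight at \<open>q\<close>. Then \<open>v\<close> is a negative multiple of
  \<open>excess n q\<close>, which vanishes whenever \<open>k\<close> does not.\<close>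

lemma ex_pareto_multipliers:
  assumes n: "n \<ge> 1" and q: "0 < q" "q < 1" "excess n q \<le> 0"
    and k: "0 \<le> k" "k < 1" "(1 - k) * mean_gap q = 1 - p" "k = 0 \<or> excess n q = 0"
  shows "\<exists>l v. pareto_multipliers n p q k l v"
proof -
  define l where "l = n * q ^ (n - 1) / - ln (1 - q)"
  define v where "v = q ^ n - l * mean_gap q"
  have lq: "ln (1 - q) < 0" using q by auto
  have "l > 0" unfolding l_def using n q by (intro divide_pos_pos mult_pos_pos) auto
  moreover have pow: "q ^ n = q * q ^ (n - 1)"
    using n by (cases n) auto
  have "v = - (q ^ (n - 1) / - ln (1 - q) * excess n q)"
    unfolding v_def l_def excess_def pow using lq by (simp add: field_simps)
  then have "v * k = 0" using k by auto
  moreover have "\<forall>h\<in>{0..1}. h ^ n \<le> l * mean_gap h + v \<and> (h ^ n = l * mean_gap h + v \<longrightarrow> h = 0 \<or> h = q)"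
    using lagrangian_maximum[OF n q] unfolding v_def l_def[symmetric] by (force simp: algebra_simps)
  ultimately show ?thesis
    using q k unfolding pareto_multipliers_def by (intro exI[of _ l] exI[of _ v]) (auto simp: v_def)
qed

text \<open>If \<open>excess n\<close> is nowhere positive on (0, 1), \<open>k = 0\<close> serves
  every \<open>p\<close> and the threshold is 1. Otherwise \<open>excess n\<close> has a zero
  \<open>z\<close>, and the threshold is \<open>1 - mean_gap z\<close>: up to it, the solution of
  \<open>mean_gap q = 1 - p\<close> satisfies \<open>q \<ge> z\<close>; above it, \<open>q\<close>
  stays at \<open>z\<close> and a positive \<open>k\<close> adjusts the mean.\<close>

lemma pareto_threshold:
  assumes n: "n \<ge> 1"
  shows "\<exists>ps\<in>{0..1}. \<forall>p\<in>{0<..<1}. \<exists>q k l v. pareto_multipliers n p q k l v \<and>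
           (p \<le> ps \<longrightarrow> k = 0) \<and> (p > ps \<longrightarrow> k > 0)"
proof -
  have inverse: "\<exists>q\<in>{0<..<1}. mean_gap q = 1 - p" if p: "p \<in> {0<..<1}" for p
  proof -
    have "\<exists>q\<ge>0. q \<le> 1 \<and> mean_gap q = 1 - p"
      using p by (intro IVT' continuous_on_mean_gap) auto
    then obtain q where "q \<ge> 0" "q \<le> 1" "mean_gap q = 1 - p" by blast
    with p show ?thesis
      by (intro bexI[of _ q]) (auto simp: less_le)
  qed
  show ?thesis
  proof (cases "\<forall>q\<in>{0<..<1}. excess n q \<le> 0")
    case True
    have "\<exists>q l v. pareto_multipliers n p q 0 l v" if p: "p \<in> {0<..<1}" for p
    proof -
      obtain q where "q \<in> {0<..<1}" "mean_gap q = 1 - p" using inverse[OF p] by blast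
      with True show ?thesis
        using ex_pareto_multipliers[OF n, of q 0 p] by auto
    qed
    then show ?thesis
      by (intro bexI[of _ 1] ballI) force+
  next
    case False
    then obtain h where h: "0 < h" "h < 1" "excess n h > 0" by force
    define t where "t = 1 - exp (- real n)"
    note t = excess_neg_near_1[OF n, folded t_def]
    have "h < t"
    proof (rule ccontr)
      assume "\<not> h < t"
      then show False
        using excess_strict_antimono[OF t(1), of n h] t(3) h by (cases "h = t") auto
    qed
    have "\<exists>x\<ge>h. x \<le> t \<and> excess n x = 0"
      using h t \<open>h < t\<close>
      by (intro IVT2' continuous_at_imp_continuous_on ballI
          DERIV_isCont[OF has_real_derivative_excess]) auto
    then obtain z where "h \<le> z" "z \<le> t" "excess n z = 0"
      by blast
    then have z: "0 < z" "z < 1" "excess n z = 0"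
      using h t by auto
    have "\<exists>q k l v. pareto_multipliers n p q k l v \<and>
           (p \<le> 1 - mean_gap z \<longrightarrow> k = 0) \<and> (p > 1 - mean_gap z \<longrightarrow> k > 0)"
      if p: "p \<in> {0<..<1}" for p
    proof (cases "p \<le> 1 - mean_gap z")
      case True
      obtain q where q: "q \<in> {0<..<1}" "mean_gap q = 1 - p" using inverse[OF p] by blast
      then have "z \<le> q"
        using mean_gap_strict_mono[of q z] True z by force
      then have "excess n q \<le> 0"
        using excess_strict_antimono[OF z(1), of n q] q z by (cases "z = q") auto
      with True q show ?thesis
        using ex_pareto_multipliers[OF n, of q 0 p] by auto
    next
      case False
      have D: "mean_gap z > 0" using mean_gap_pos z by auto
      have "0 < (1 - p) / mean_gap z" "(1 - p) / mean_gap z < 1"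
        using p D False by auto
      then show ?thesis
        using ex_pareto_multipliers[OF n z(1,2), of "1 - (1 - p) / mean_gap z" p] D z False
        by force
    qed
    then show ?thesis
      using mean_gap_bounds[of z] z by (intro bexI[of _ "1 - mean_gap z"]) auto
  qed
qed

section \<open>Ironed virtual values and the quantile function\<close>

text \<open>Over a mesh of \<open>N\<close> equal steps the increments of the error \<open>E\<close>
  are at most those of \<open>f\<close> times \<open>(b - a) / N\<close>. These telescope, and the
  total tends to 0.\<close>

lemma monotone_slope_integral_bound:
  fixes f F :: "real \<Rightarrow> real"
  assumes ab: "a \<le> b" and f: "mono_on {a..b} f"
    and F: "\<And>x y. a \<le> x \<Longrightarrow> x \<le> y \<Longrightarrow> y \<le> b \<Longrightarrow> F y - F x \<le> f y * (y - x)"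
  shows "F b - F a \<le> integral {a..b} f"
proof -
  define E where "E x = F x - integral {a..x} f" for x
  have step: "E y - E x \<le> (f y - f x) * (y - x)" if "a \<le> x" "x \<le> y" "y \<le> b" for x y
  proof -
    have int: "f integrable_on {c..d}" if "a \<le> c" "d \<le> b" for c d
      using that by (intro integrable_on_mono_on mono_on_subset[OF f]) auto
    have "f x * (y - x) = integral {x..y} (\<lambda>_. f x)"
      using that by simp
    also have "\<dots> \<le> integral {x..y} f"
      using that by (intro integral_le int) (auto intro!: mono_onD[OF f])
    also have "\<dots> = integral {a..y} f - integral {a..x} f"
      using Henstock_Kurzweil_Integration.integral_combine[of a x y f] that int[of a y] by simp
    finally show ?thesis
      using F[OF that] by (simp add: E_def algebra_simps)
  qed
  have bound: "E b - E a \<le> (f b - f a) * (b - a) / real N" if "N > 0" for N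
  proof -
    define x where "x i = a + real i * (b - a) / real N" for i
    have x: "a \<le> x i" "x i \<le> x (Suc i)" for i
      using ab by (auto simp: x_def intro!: divide_right_mono mult_right_mono)
    have xb: "x i \<le> b" if "i \<le> N" for i
    proof -
      have "real i * (b - a) \<le> real N * (b - a)"
        using that ab by (intro mult_right_mono) auto
      then show ?thesis
        using \<open>N > 0\<close> by (simp add: x_def field_simps)
    qed
    have dx: "x (Suc i) - x i = (b - a) / N" for i
      by (simp add: x_def diff_divide_distrib[symmetric] algebra_simps)
    have "E b - E a = (\<Sum>i<N. E (x (Suc i)) - E (x i))"
      using sum_lessThan_telescope[of "\<lambda>i. E (x i)" N] \<open>N > 0\<close> by (simp add: x_def)
    also have "\<dots> \<le> (\<Sum>i<N. (f (x (Suc i)) - f (x i)) * ((b - a) / N))"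
    proof (rule sum_mono)
      fix i assume "i \<in> {..<N}"
      then show "E (x (Suc i)) - E (x i) \<le> (f (x (Suc i)) - f (x i)) * ((b - a) / N)"
        using step[of "x i" "x (Suc i)"] x[of i] xb[of "Suc i"] by (simp only: dx) simp
    qed
    also have "\<dots> = (f b - f a) * ((b - a) / N)"
      using sum_lessThan_telescope[of "\<lambda>i. f (x i)" N] \<open>N > 0\<close>
      unfolding sum_distrib_right[symmetric] by (simp add: x_def)
    finally show ?thesis by simp
  qed
  have "E b - E a \<le> 0"
  proof (rule tendsto_lowerbound)
    show "(\<lambda>N. (f b - f a) * (b - a) / real N) \<longlonglongrightarrow> 0"
      by (rule lim_const_over_n)
    show "\<forall>\<^sub>F N in sequentially. E b - E a \<le> (f b - f a) * (b - a) / real N"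
      using eventually_gt_at_top[of 0] by eventually_elim (rule bound)
  qed simp
  then show ?thesis by (simp add: E_def)
qed

text \<open>Meaningful for \<open>u\<close> in (0, 1], where for a CDF on [0, 1] the set is nonempty
  and bounded below by 0. For \<open>u \<le> 0\<close> the set is the whole line.\<close>

definition quantile :: "(real \<Rightarrow> real) \<Rightarrow> real \<Rightarrow> real" where
  "quantile G u = Inf {x. u \<le> G x}"

text \<open>The maximum with 0 removes the value -infinity before the passage to the reals;
  \<open>ironed_vv_le_1\<close> excludes +infinity on [0, 1].\<close>

definition pos_vv :: "(real \<Rightarrow> real) \<Rightarrow> real \<Rightarrow> real" where
  "pos_vv G x = real_of_ereal (max 0 (ironed_vv G x))"

locale signal_cdf =
  fixes G :: "real \<Rightarrow> real"
  assumes cdf01: "cdf01 G"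
begin

lemma G_mono: "x \<le> y \<Longrightarrow> G x \<le> G y"
  using cdf01 by (auto simp: cdf01_def dest: monoD)

lemma G_neg: "x < 0 \<Longrightarrow> G x = 0" and G_ge_1: "1 \<le> x \<Longrightarrow> G x = 1"
  using cdf01 by (auto simp: cdf01_def)

lemma G_right_cont: "continuous (at_right x) G"
  using cdf01 by (auto simp: cdf01_def)

lemma G_bounds: "0 \<le> G x" "G x \<le> 1"
  using G_mono[of "min x (-1)" x] G_mono[of x "max x 1"] by (auto simp: G_neg G_ge_1)

section \<open>The convex hull and its sub-gradients\<close>

lemma lower_end_le: "x \<in> {0..1} \<Longrightarrow> G x > 0 \<Longrightarrow> lower_end G \<le> x"
  unfolding lower_end_def by (rule cInf_lower) (auto intro: bdd_belowI[of _ 0])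

lemma lower_end_bounds: "0 \<le> lower_end G" "lower_end G \<le> 1"
proof -
  show "lower_end G \<le> 1" by (rule lower_end_le) (auto simp: G_ge_1)
  have "1 \<in> {x \<in> {0..1}. 0 < G x}" by (auto simp: G_ge_1)
  then show "0 \<le> lower_end G"
    unfolding lower_end_def by (intro cInf_greatest) auto
qed

lemma below_lower_end: "x < lower_end G \<Longrightarrow> G x = 0"
  using lower_end_le[of x] G_bounds(1)[of x] G_neg[of x] lower_end_bounds
  by (cases "x < 0") (auto simp: less_le)

text \<open>The line of slope 1 that meets \<open>Psi G\<close> where \<open>G x = 1\<close>. It
  makes the set of minorants nonempty and leads to the upper bound 1 on ironed virtual
  values.\<close>

lemma top_minorant: "(lower_end G - 1, 1) \<in> affine_minorants G"
proof -
  have "lower_end G - 1 + G x \<le> Psi G x" if "x \<in> {0..1}" for x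
  proof (cases "x < lower_end G")
    case True
    then show ?thesis using below_lower_end[of x] lower_end_bounds by (simp add: Psi_def)
  next
    case False
    have "x * (1 - G x) \<le> 1 * (1 - G x)"
      using that G_bounds(2)[of x] by (intro mult_right_mono) auto
    with False show ?thesis by (simp add: Psi_def)
  qed
  then show ?thesis by (auto simp: affine_minorants_def)
qed

lemma minorant_le_Phi: "(b0, b1) \<in> affine_minorants G \<Longrightarrow> x \<in> {0..1} \<Longrightarrow> b0 + b1 * G x \<le> Phi G x"
  unfolding Phi_def
  by (rule cSUP_upper2[where x = "(b0, b1)"])
     (auto simp: affine_minorants_def intro!: bdd_aboveI[of _ "Psi G x"])

lemma Phi_least: "(\<And>b0 b1. (b0, b1) \<in> affine_minorants G \<Longrightarrow> b0 + b1 * G x \<le> c) \<Longrightarrow> Phi G x \<le> c"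
  unfolding Phi_def using top_minorant by (intro cSUP_least) auto

lemma Phi_le_Psi: "x \<in> {0..1} \<Longrightarrow> Phi G x \<le> Psi G x"
  by (rule Phi_least) (auto simp: affine_minorants_def)

lemma Phi_cong: "G x = G y \<Longrightarrow> Phi G x = Phi G y"
  by (simp add: Phi_def)

lemma ironed_vv_cong: "G x = G y \<Longrightarrow> ironed_vv G x = ironed_vv G y"
proof -
  assume "G x = G y"
  then have "subgradients G x = subgradients G y"
    using Phi_cong[of x y] by (simp add: subgradients_def)
  then show ?thesis by (simp add: ironed_vv_def)
qed

text \<open>A supremum of functions affine in \<open>G x\<close> is convex in that variable; this is
  the chord inequality with denominators cleared.\<close>

lemma Phi_convex:
  assumes "x \<in> {0..1}" "z \<in> {0..1}" "G x \<le> G y" "G y \<le> G z" "G x < G z"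
  shows "(G z - G x) * Phi G y \<le> (G z - G y) * Phi G x + (G y - G x) * Phi G z"
proof -
  have "Phi G y \<le> ((G z - G y) * Phi G x + (G y - G x) * Phi G z) / (G z - G x)"
  proof (rule Phi_least)
    fix b0 b1 assume b: "(b0, b1) \<in> affine_minorants G"
    have "(b0 + b1 * G y) * (G z - G x)
        = (G z - G y) * (b0 + b1 * G x) + (G y - G x) * (b0 + b1 * G z)"
      by (simp add: algebra_simps)
    also have "\<dots> \<le> (G z - G y) * Phi G x + (G y - G x) * Phi G z"
      using assms minorant_le_Phi[OF b] by (intro add_mono mult_left_mono) auto
    finally show "b0 + b1 * G y \<le> ((G z - G y) * Phi G x + (G y - G x) * Phi G z) / (G z - G x)"
      using assms by (simp add: field_simps)
  qed
  then show ?thesis using assms by (simp add: field_simps)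
qed

lemma Phi_top: assumes "x \<in> {0..1}" "G x = 1" shows "Phi G x = lower_end G"
proof (rule antisym)
  have "Phi G x = Phi G 1" using assms by (intro Phi_cong) (simp add: G_ge_1)
  also have "\<dots> \<le> Psi G 1" by (rule Phi_le_Psi) simp
  also have "\<dots> = lower_end G" using lower_end_bounds by (simp add: Psi_def G_ge_1)
  finally show "Phi G x \<le> lower_end G" .
  show "lower_end G \<le> Phi G x"
    using minorant_le_Phi[OF top_minorant assms(1)] assms by simp
qed

lemma one_subgradient_top: "x \<in> {0..1} \<Longrightarrow> G x = 1 \<Longrightarrow> 1 \<in> subgradients G x"
  using minorant_le_Phi[OF top_minorant] Phi_top[of x] by (force simp: subgradients_def)

lemma subgradients_strict_mono:
  assumes "x \<in> {0..1}" "y \<in> {0..1}" "G x < G y" "w \<in> subgradients G x" "v \<in> subgradients G y"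
  shows "w \<le> v"
proof -
  have "w * (G y - G x) \<le> Phi G y - Phi G x" "v * (G x - G y) \<le> Phi G x - Phi G y"
    using assms by (auto simp: subgradients_def)
  then have "w * (G y - G x) \<le> v * (G y - G x)" by (simp add: algebra_simps)
  with assms show ?thesis by simp
qed

text \<open>The ironed virtual value is the left derivative of the convex hull. It exists wherever
  \<^term>\<open>G x\<close> exceeds its least value; at \<^term>\<open>G x = 1\<close> the minorant of slope 1 bounds the slopes.\<close>

lemma ironed_vv_attained:
  assumes x: "x \<in> {0..1}" and G0: "G 0 < G x"
  shows "\<exists>w \<in> subgradients G x. ironed_vv G x = ereal w"
proof -
  \<comment> \<open>Slopes, in the variable \<open>G x\<close>, of the chords ending at
    \<open>x\<close> from the left.\<close>
  define S where "S = (\<lambda>z. (Phi G x - Phi G z) / (G x - G z)) ` {z \<in> {0..1}. G z < G x}"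
  have ne: "S \<noteq> {}" using x G0 by (auto simp: S_def intro!: exI[of _ 0])
  have right: "s \<le> (Phi G y - Phi G x) / (G y - G x)" if s: "s \<in> S" and "y \<in> {0..1}" "G x < G y" for s y
  proof -
    obtain z where z: "z \<in> {0..1}" "G z < G x" "s = (Phi G x - Phi G z) / (G x - G z)"
      using s unfolding S_def by blast
    have "(G y - G z) * Phi G x \<le> (G y - G x) * Phi G z + (G x - G z) * Phi G y"
      using z that by (intro Phi_convex) auto
    then have "(Phi G x - Phi G z) * (G y - G x) \<le> (Phi G y - Phi G x) * (G x - G z)"
      by (simp add: algebra_simps)
    then show ?thesis
      using z that by (simp add: divide_le_eq pos_le_divide_eq)
  qed
  have subgr: "s \<le> v" if s: "s \<in> S" and "v \<in> subgradients G x" for s v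
  proof -
    obtain z where z: "z \<in> {0..1}" "G z < G x" "s = (Phi G x - Phi G z) / (G x - G z)"
      using s unfolding S_def by blast
    have "v * (G z - G x) \<le> Phi G z - Phi G x"
      using that z by (auto simp: subgradients_def)
    then show ?thesis using z by (simp add: divide_le_eq algebra_simps)
  qed
  have bdd: "bdd_above S"
  proof (cases "G x = 1")
    case True
    then show ?thesis
      using subgr[OF _ one_subgradient_top[OF x]] by (auto intro: bdd_aboveI[of _ 1])
  next
    case False
    then have "G x < G 1" using G_bounds[of x] by (simp add: G_ge_1)
    then have "s \<le> (Phi G 1 - Phi G x) / (G 1 - G x)" if "s \<in> S" for s
      using right[OF that, of 1] by simp
    then show ?thesis by (rule bdd_aboveI)
  qed
  define w where "w = Sup S"
  have w: "w \<in> subgradients G x"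
    unfolding subgradients_def
  proof (intro CollectI ballI)
    fix z :: real assume z: "z \<in> {0..1}"
    consider "G z < G x" | "G z = G x" | "G x < G z" by linarith
    then show "w * (G z - G x) \<le> Phi G z - Phi G x"
    proof cases
      case 1
      then have "(Phi G x - Phi G z) / (G x - G z) \<le> w"
        unfolding w_def using z by (intro cSup_upper bdd) (auto simp: S_def)
      with 1 show ?thesis by (simp add: divide_le_eq algebra_simps)
    next
      case 2
      then show ?thesis using Phi_cong[of z x] by simp
    next
      case 3
      then have "w \<le> (Phi G z - Phi G x) / (G z - G x)"
        unfolding w_def using z by (intro cSup_least ne right) auto
      with 3 show ?thesis by (simp add: pos_le_divide_eq)
    qed
  qed
  \<comment> \<open>By \<open>subgr\<close> every sub-gradient is an upper bound of
    \<open>S\<close>, so \<open>Sup S\<close> is the least one.\<close>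
  have "(INF w \<in> subgradients G x. ereal w) = ereal w"
  proof (rule antisym)
    show "(INF w \<in> subgradients G x. ereal w) \<le> ereal w" using w by (rule INF_lower)
    show "ereal w \<le> (INF w \<in> subgradients G x. ereal w)"
      unfolding w_def using ne subgr by (auto intro!: INF_greatest cSup_least)
  qed
  then show ?thesis using w by (auto simp: ironed_vv_def intro!: bexI[of _ w])
qed

lemma ironed_vv_le: "w \<in> subgradients G x \<Longrightarrow> ironed_vv G x \<le> ereal w"
  by (auto simp: ironed_vv_def intro: INF_lower)

lemma ironed_vv_mono:
  assumes "x \<in> {0..1}" "y \<in> {0..1}" "x \<le> y" shows "ironed_vv G x \<le> ironed_vv G y"
proof (cases "G x = G y")
  case True
  show ?thesis by (simp add: ironed_vv_cong[OF True])
next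
  case False
  then have lt: "G x < G y" using G_mono[OF assms(3)] by simp
  \<comment> \<open>This gives \<open>y\<close> a least sub-gradient; at \<open>x\<close> there may
    be none, and the value is then -infinity.\<close>
  then have "G 0 < G y" using G_mono[of 0 x] assms by auto
  then obtain v where v: "v \<in> subgradients G y" "ironed_vv G y = ereal v"
    using ironed_vv_attained assms by blast
  show ?thesis
  proof (cases "subgradients G x = {}")
    case True
    then show ?thesis by (simp add: ironed_vv_def)
  next
    case False
    then obtain w where w: "w \<in> subgradients G x" by blast
    have "ironed_vv G x \<le> ereal w" by (rule ironed_vv_le[OF w])
    also have "\<dots> \<le> ereal v" using subgradients_strict_mono[OF assms(1,2) lt w v(1)] by simp
    finally show ?thesis by (simp add: v)
  qed
qed

lemma ironed_vv_le_1: "x \<in> {0..1} \<Longrightarrow> ironed_vv G x \<le> 1"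
  using ironed_vv_mono[of x 1] ironed_vv_le[OF one_subgradient_top, of 1]
  by (auto simp: G_ge_1 one_ereal_def intro: order_trans)

lemma ereal_pos_vv: "x \<in> {0..1} \<Longrightarrow> ereal (pos_vv G x) = max 0 (ironed_vv G x)"
  using ironed_vv_le_1[of x] unfolding pos_vv_def
  by (cases "ironed_vv G x") (auto simp: max_def)

lemma pos_vv_bounds:
  assumes "x \<in> {0..1}" shows "0 \<le> pos_vv G x" "pos_vv G x \<le> 1"
proof -
  have "ereal 0 \<le> ereal (pos_vv G x)" "ereal (pos_vv G x) \<le> ereal 1"
    unfolding ereal_pos_vv[OF assms] using ironed_vv_le_1[OF assms]
    by (simp_all flip: zero_ereal_def one_ereal_def)
  then show "0 \<le> pos_vv G x" "pos_vv G x \<le> 1" by simp_all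
qed

lemma pos_vv_mono:
  assumes "x \<in> {0..1}" "y \<in> {0..1}" "x \<le> y" shows "pos_vv G x \<le> pos_vv G y"
proof -
  have "ereal (pos_vv G x) \<le> ereal (pos_vv G y)"
    unfolding ereal_pos_vv[OF assms(1)] ereal_pos_vv[OF assms(2)]
    by (intro max.mono ironed_vv_mono assms order_refl)
  then show ?thesis by simp
qed

lemma pos_vv_le:
  assumes "x \<in> {0..1}" "w \<in> subgradients G x" "0 \<le> w" shows "pos_vv G x \<le> w"
proof -
  have "ereal (pos_vv G x) \<le> ereal w"
    unfolding ereal_pos_vv[OF assms(1)] using ironed_vv_le[OF assms(2)] assms(3) by simp
  then show ?thesis by simp
qed

section \<open>The quantile function as a generalized inverse\<close>

lemma quantile_le_iff:
  assumes "0 < u" "u \<le> 1" shows "quantile G u \<le> x \<longleftrightarrow> u \<le> G x"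
proof -
  let ?F = "{x. u \<le> G x}"
  have bdd: "bdd_below ?F"
    using assms by (intro bdd_belowI[of _ 0]) (auto simp: not_less[symmetric] G_neg)
  have ne: "?F \<noteq> {}" using assms by (auto simp: G_ge_1 intro!: exI[of _ 1])
  have "mono G" by (auto intro: monoI G_mono)
  \<comment> \<open>Right continuity of \<open>G\<close> makes the infimum a member of the
    set.\<close>
  have "u \<le> (INF s\<in>?F. G s)" by (rule cINF_greatest[OF ne]) auto
  also have "\<dots> = G (quantile G u)"
    unfolding quantile_def using continuous_at_Inf_mono[OF \<open>mono G\<close> G_right_cont ne bdd] ..
  finally have "u \<le> G (quantile G u)" .
  moreover have "u \<le> G x \<Longrightarrow> quantile G u \<le> x"
    unfolding quantile_def by (auto intro!: cInf_lower bdd)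
  ultimately show ?thesis using G_mono by (meson order_trans)
qed

lemma quantile_bounds:
  assumes "0 < u" "u \<le> 1" shows "0 \<le> quantile G u" "quantile G u \<le> 1"
proof -
  show "quantile G u \<le> 1" using assms by (simp add: quantile_le_iff G_ge_1)
  show "0 \<le> quantile G u"
    using quantile_le_iff[OF assms, of "quantile G u"] assms G_neg[of "quantile G u"] by force
qed

lemma le_G_quantile: "0 < u \<Longrightarrow> u \<le> 1 \<Longrightarrow> u \<le> G (quantile G u)"
  using quantile_le_iff by blast

lemma quantile_mono: "0 < u \<Longrightarrow> u \<le> v \<Longrightarrow> v \<le> 1 \<Longrightarrow> quantile G u \<le> quantile G v"
  using le_G_quantile[of v] by (simp add: quantile_le_iff)

text \<open>In quantile space the hull \<open>F\<close> has slopes at most the integrand, equals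
  \<open>lower_end G\<close> at 1, and is at most
  \<open>lower_end G - (1 - q) * quantile G q\<close> at \<open>q\<close>. So the integral bounds
  the increment of \<open>F\<close> over \<open>{q..1}\<close>.\<close>

lemma quantile_revenue_le:
  assumes q: "0 < q" "q \<le> 1"
  shows "(1 - q) * quantile G q \<le> integral {q..1} (\<lambda>u. pos_vv G (quantile G u))"
proof -
  define f where "f u = pos_vv G (quantile G u)" for u
  have f0: "f u \<ge> 0" if "q \<le> u" "u \<le> 1" for u
    unfolding f_def using that q by (intro pos_vv_bounds) (simp add: quantile_bounds)
  have fmono: "mono_on {q..1} f"
    unfolding f_def using q
    by (auto intro!: mono_onI pos_vv_mono quantile_mono simp: quantile_bounds)
  show ?thesis
  proof (cases "quantile G q > 0")
    case False
    then have "quantile G q = 0" using quantile_bounds[OF q] by simp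
    moreover have "0 \<le> integral {q..1} f"
      using f0 by (intro integral_nonneg integrable_on_mono_on fmono) auto
    ultimately show ?thesis by (simp add: f_def[symmetric])
  next
    case True
    define w where "w x = real_of_ereal (ironed_vv G x)" for x
    \<comment> \<open>A positive quantile at \<open>q\<close> means \<open>G 0 < q\<close>; this
      secures a least sub-gradient at every quantile from \<open>q\<close> on.\<close>
    have G0: "G 0 < G (quantile G u)" if "q \<le> u" "u \<le> 1" for u
    proof -
      have "\<not> quantile G q \<le> 0" using True by simp
      then have "G 0 < q" using q by (simp add: quantile_le_iff)
      also have "q \<le> G (quantile G u)" using le_G_quantile[of u] that q by simp
      finally show ?thesis .
    qed
    have w: "w (quantile G u) \<in> subgradients G (quantile G u)"
        "ironed_vv G (quantile G u) = ereal (w (quantile G u))" if "q \<le> u" "u \<le> 1" for u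
      using ironed_vv_attained[OF _ G0[OF that]] quantile_bounds[of u] that q by (auto simp: w_def)
    have wf: "w (quantile G u) \<le> f u" if "q \<le> u" "u \<le> 1" for u
      using w(2)[OF that] by (auto simp: f_def pos_vv_def max_def)
    have range: "quantile G u \<in> {0..1}" if "q \<le> u" "u \<le> 1" for u
      using quantile_bounds[of u] that q by auto
    text \<open>The convex hull interpolates linearly across an atom; \<^term>\<open>F u\<close> is its value at the
      quantile \<^term>\<open>u\<close>, so \<^term>\<open>lower_end G - F u\<close> is the ironed revenue curve.\<close>
    define F where "F u = Phi G (quantile G u) - w (quantile G u) * (G (quantile G u) - u)" for u
    have "F v - F u \<le> f v * (v - u)" if uv: "q \<le> u" "u \<le> v" "v \<le> 1" for u v
    proof -
      let ?X = "quantile G u" and ?Y = "quantile G v"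
      have "F v - F u \<le> w ?Y * (v - u)"
      proof (cases "G ?X = G ?Y")
        case True
        then have "w ?X = w ?Y" "Phi G ?X = Phi G ?Y"
          unfolding w_def by (simp_all only: ironed_vv_cong[OF True] Phi_cong[OF True])
        with True show ?thesis by (simp add: F_def algebra_simps)
      next
        case False
        have le: "?X \<le> ?Y" using quantile_mono uv q by auto
        with False have lt: "G ?X < G ?Y" using G_mono[OF le] by auto
        have "\<not> ?Y \<le> ?X" using le lt by auto
        then have "G ?X < v" using uv q by (simp add: quantile_le_iff)
        have "u \<le> G ?X" using le_G_quantile uv q by auto
        have ww: "w ?X \<le> w ?Y"
          using subgradients_strict_mono[OF range range lt w(1) w(1)] uv by auto
        have "Phi G ?X - Phi G ?Y \<ge> w ?Y * (G ?X - G ?Y)"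
          using w(1)[of v] range[of u] uv by (auto simp: subgradients_def)
        moreover have "w ?X * (G ?X - u) \<le> w ?Y * (G ?X - u)"
          using ww \<open>u \<le> G ?X\<close> by (intro mult_right_mono) auto
        ultimately show ?thesis by (simp add: F_def algebra_simps)
      qed
      also have "\<dots> \<le> f v * (v - u)"
        using wf[of v] uv by (intro mult_right_mono) auto
      finally show ?thesis .
    qed
    then have "F 1 - F q \<le> integral {q..1} f"
      using q fmono by (intro monotone_slope_integral_bound) auto
    moreover have "F 1 = lower_end G"
    proof -
      have "G (quantile G 1) = 1"
        using le_G_quantile[of 1] G_bounds[of "quantile G 1"] by simp
      then show ?thesis using Phi_top[of "quantile G 1"] range[of 1] q by (simp add: F_def)
    qed
    moreover have "F q \<le> lower_end G - quantile G q * (1 - q)"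
    proof -
      define X where "X = quantile G q"
      have X: "X \<in> {0..1}" "X > 0" "q \<le> G X"
        using range[of q] q True le_G_quantile by (auto simp: X_def)
      have PX: "Phi G X \<le> lower_end G - X * (1 - G X)"
        using Phi_le_Psi[OF X(1)] lower_end_le[OF X(1)] X q by (auto simp: Psi_def)
      \<comment> \<open>\<open>q\<close> may lie inside the jump of \<open>G\<close> at
        \<open>X\<close>, a level at which \<open>Psi G\<close> gives no bound. The bound is
        interpolated between the level \<open>G X\<close> and the level of a point \<open>z\<close>
        at most \<open>e\<close> to the left of \<open>X\<close>.\<close>
      have "F q - (lower_end G - X * (1 - q)) \<le> e" if "e > 0" for e
      proof -
        define z where "z = max 0 (X - e)"
        have z: "z \<in> {0..1}" "z < X" "X - z \<le> e" using X that by (auto simp: z_def)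
        have "G z < q" using z(2) q quantile_le_iff[of q z] by (simp add: X_def)
        have "Phi G z \<le> lower_end G - z * (1 - G z)"
          using Phi_le_Psi[OF z(1)] below_lower_end[of z] by (auto simp: Psi_def split: if_splits)
        also have "\<dots> \<le> lower_end G - X * (1 - G z) + (X - z)"
          using z G_bounds[of z] mult_left_mono[of "1 - G z" 1 "X - z"] by (simp add: algebra_simps)
        finally have "Phi G z \<le> lower_end G - X * (1 - G z) + e"
          using z by simp
        moreover have "Phi G z - Phi G X \<ge> w X * (G z - G X)"
          using w(1)[of q] z(1) q by (auto simp: subgradients_def X_def)
        ultimately have dz: "Phi G X + w X * (G z - G X) - (lower_end G - X * (1 - G z)) \<le> e"
          by simp
        \<comment> \<open>\<open>d\<close> is affine, \<open>d (G X) \<le> 0\<close> and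
          \<open>d (G z) \<le> e\<close>; as \<open>q\<close> lies between \<open>G z\<close> and
          \<open>G X\<close>, also \<open>d q \<le> e\<close>.\<close>
        define d where "d t = Phi G X + w X * (t - G X) - (lower_end G - X * (1 - t))" for t
        have "(G X - G z) * d q = (G X - q) * d (G z) + (q - G z) * d (G X)"
          by (simp add: d_def algebra_simps)
        also have "\<dots> \<le> (G X - q) * e + (q - G z) * e"
          using dz PX X \<open>G z < q\<close> that by (intro add_mono mult_left_mono) (auto simp: d_def)
        also have "\<dots> = (G X - G z) * e" by (simp add: algebra_simps)
        finally have "d q \<le> e" using \<open>G z < q\<close> X by simp
        then show ?thesis by (simp add: d_def F_def X_def algebra_simps)
      qed
      then have "F q - (lower_end G - X * (1 - q)) \<le> 0"
        using field_le_epsilon[of "F q - (lower_end G - X * (1 - q))" 0] by simp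
      then show ?thesis by (simp add: X_def)
    qed
    ultimately show ?thesis by (simp add: f_def[symmetric] algebra_simps)
  qed
qed

end

section \<open>Reduction to the distribution of the virtual value\<close>

abbreviation unif :: "real measure" where
  "unif \<equiv> restrict_space lborel {0<..<1}"

lemma space_unif [simp]: "space unif = {0<..<1}"
  by (simp add: space_restrict_space)

lemma prob_space_unif: "prob_space unif"
  by (auto simp: space_restrict_space emeasure_restrict_space intro!: prob_spaceI)

interpretation unif: prob_space unif
  by (rule prob_space_unif)

lemma measurable_ident_unif: "(\<lambda>x. x) \<in> borel_measurable unif"
  by (intro measurable_restrict_space1) simp

lemma borel_measurable_unif: "f \<in> borel_measurable borel \<Longrightarrow> f \<in> borel_measurable unif"
  by (intro measurable_restrict_space1) (simp add: measurable_lborel1)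

lemma measure_unif_Ioo:
  "0 \<le> a \<Longrightarrow> a \<le> b \<Longrightarrow> b \<le> 1 \<Longrightarrow> measure unif {a<..<b} = b - a"
  by (subst measure_restrict_space) auto

text \<open>Links the Lebesgue integral over (0, 1) with the gauge integral of
  \<open>quantile_revenue_le\<close>; endpoints carry no mass.\<close>

lemma integral_unif_eq_HK:
  fixes f :: "real \<Rightarrow> real"
  assumes f: "f \<in> borel_measurable unif" and bnd: "\<And>u. u \<in> {0<..<1} \<Longrightarrow> \<bar>f u\<bar> \<le> B"
    and q: "0 \<le> q" "q < 1"
  shows "(LINT u|unif. indicator {q<..} u * f u) = integral {q..1} f"
proof -
  note [measurable] = f measurable_ident_unif
  have eq: "indicator {0<..<1} u * (indicator {q<..} u * f u) = indicator {q<..<1} u * f u" for u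
    using q by (auto simp: indicator_def)
  have "integrable unif (\<lambda>u. indicator {q<..} u * f u)"
  proof (rule unif.integrable_const_bound[of _ B])
    show "AE u in unif. norm (indicator {q<..} u * f u) \<le> B"
      using bnd by (intro AE_I2) (force simp: indicator_def)
    show "(\<lambda>u. indicator {q<..} u * f u) \<in> borel_measurable unif"
      by measurable
  qed
  then have "set_integrable lborel {q<..<1} f"
    by (simp add: integrable_restrict_space set_integrable_def eq)
  then have "(LINT u:{q<..<1}|lborel. f u) = integral {q<..<1} f"
    by (rule set_borel_integral_eq_integral)
  then show ?thesis
    by (simp add: integral_restrict_space set_lebesgue_integral_def integral_open_interval_real eq)
qed

lemma min_ratio_bounds: "h \<in> {0..1} \<Longrightarrow> q < 1 \<Longrightarrow> \<bar>min 1 ((1 - h) / (1 - q :: real))\<bar> \<le> 1"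
  by (auto simp: abs_le_iff min_def intro: order_trans[of _ 0])

text \<open>The integrand is \<open>(1 - h) / (1 - u)\<close> up to \<open>h\<close> and 1 beyond,
  which contributes \<open>- (1 - h) * ln (1 - h)\<close> and \<open>1 - h\<close>.\<close>

lemma integral_min_ratio:
  assumes h: "0 \<le> h" "h \<le> 1"
  shows "(LINT u|unif. min 1 ((1 - h) / (1 - u))) = 1 - mean_gap h"
proof (cases "h = 1")
  case True
  then show ?thesis by simp
next
  case False
  then have h1: "h < 1" using h by simp
  let ?f = "\<lambda>u::real. min 1 ((1 - h) / (1 - u))"
  have left: "(?f has_integral - (1 - h) * ln (1 - h) - - (1 - h) * ln (1 - 0)) {0..h}"
  proof (rule has_integral_eq)
    show "((\<lambda>u. (1 - h) / (1 - u)) has_integral - (1 - h) * ln (1 - h) - - (1 - h) * ln (1 - 0)) {0..h}"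
      using h h1 by (intro fundamental_theorem_of_calculus)
        (auto intro!: derivative_eq_intros simp: field_simps simp flip: has_real_derivative_iff_has_vector_derivative)
  qed (use h1 in auto)
  have right: "(?f has_integral (1 - h)) {h..1}"
  proof (rule has_integral_spike_finite)
    show "((\<lambda>_. 1) has_integral (1 - h)) {h..1}"
      using has_integral_const_real[of "1::real" h 1] h by simp
    \<comment> \<open>At \<open>u = 1\<close> division by zero makes the ratio 0, so this point is
      excepted.\<close>
    show "?f u = 1" if "u \<in> {h..1} - {1}" for u
      using that by auto
  qed simp
  have "(?f has_integral (- (1 - h) * ln (1 - h) + (1 - h))) {0..1}"
    using has_integral_combine[OF h left right] by simp
  then have "integral {0..1} ?f = 1 - mean_gap h"
    by (simp add: integral_unique mean_gap_def algebra_simps)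
  moreover have "(LINT u|unif. indicator {0<..} u * ?f u) = integral {0..1} ?f"
    using min_ratio_bounds[of h] h
    by (intro integral_unif_eq_HK[of _ 1] borel_measurable_unif) (auto simp del: min_less_iff_conj)
  moreover have "(LINT u|unif. indicator {0<..} u * ?f u) = (LINT u|unif. ?f u)"
    by (intro Bochner_Integration.integral_cong) auto
  ultimately show ?thesis by simp
qed

text \<open>\<open>Z x\<close> is the length of the set of \<open>t\<close> in (0, 1) with
  \<open>t < Z x\<close>; Fubini exchanges the integrals.\<close>

lemma (in prob_space) integral_layer_cake:
  assumes Z [measurable]: "Z \<in> borel_measurable M" and Z01: "\<And>x. x \<in> space M \<Longrightarrow> Z x \<in> {0..1}"
  shows "(LINT x|M. Z x) = (LINT t|unif. measure M {x \<in> space M. t < Z x})"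
proof -
  interpret pair_prob_space M unif
    by (simp add: pair_prob_space_def pair_sigma_finite_def prob_space_axioms prob_space_unif
        sigma_finite_measure_axioms unif.sigma_finite_measure_axioms)
  note [measurable] = measurable_ident_unif
  have int: "integrable (M \<Otimes>\<^sub>M unif) (\<lambda>(x, t). if t < Z x then 1 else 0 :: real)"
    by (rule P.integrable_const_bound[of _ 1]) (auto intro!: AE_I2)
  have "(LINT x|M. Z x) = (LINT x|M. LINT t|unif. (if t < Z x then 1 else 0))"
  proof (rule Bochner_Integration.integral_cong[OF refl])
    fix x assume "x \<in> space M"
    then have x: "Z x \<in> {0..1}" by (rule Z01)
    have "(LINT t|unif. (if t < Z x then 1 else 0)) = (LINT t|unif. indicator {0<..<Z x} t)"
      by (intro Bochner_Integration.integral_cong) (auto simp: indicator_def)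
    also have "\<dots> = measure unif {0<..<Z x}"
      using x by (subst Bochner_Integration.integral_indicator) (auto simp: sets_restrict_space_iff unif.emeasure_eq_measure intro!: arg_cong2[where f = measure])
    also have "\<dots> = Z x" using x by (subst measure_unif_Ioo) auto
    finally show "Z x = (LINT t|unif. (if t < Z x then 1 else 0))" ..
  qed
  also have "\<dots> = (LINT t|unif. LINT x|M. (if t < Z x then 1 else 0))"
    using Fubini_integral[OF int] by simp
  also have "\<dots> = (LINT t|unif. measure M {x \<in> space M. t < Z x})"
  proof (rule Bochner_Integration.integral_cong[OF refl])
    fix t :: real
    have "(LINT x|M. (if t < Z x then 1 else 0)) = (LINT x|M. indicator {x \<in> space M. t < Z x} x)"
      by (intro Bochner_Integration.integral_cong) (auto simp: indicator_def)
    also have "\<dots> = measure M {x \<in> space M. t < Z x}"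
      by (subst Bochner_Integration.integral_indicator) (auto intro!: arg_cong2[where f = measure])
    finally show "(LINT x|M. (if t < Z x then 1 else 0)) = measure M {x \<in> space M. t < Z x}" .
  qed
  finally show ?thesis .
qed

definition vv_cdf :: "(real \<Rightarrow> real) \<Rightarrow> real \<Rightarrow> real" where
  "vv_cdf G t = measure unif {u \<in> {0<..<1}. pos_vv G (quantile G u) \<le> t}"

context signal_cdf
begin

section \<open>Signals as quantiles of a uniform variable\<close>

lemma real_distribution_G: "real_distribution (interval_measure G)"
  and cdf_G: "cdf (interval_measure G) = G"
proof -
  have bot: "(G \<longlongrightarrow> 0) at_bot"
    by (rule tendsto_eventually) (use G_neg in \<open>auto simp: eventually_at_bot_linorder intro!: exI[of _ "-1"]\<close>)
  have top: "(G \<longlongrightarrow> 1) at_top"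
    by (rule tendsto_eventually) (use G_ge_1 in \<open>auto simp: eventually_at_top_linorder\<close>)
  show "real_distribution (interval_measure G)"
    using G_mono G_right_cont bot top by (rule real_distribution_interval_measure)
  show "cdf (interval_measure G) = G"
    using G_mono G_right_cont bot by (rule cdf_interval_measure)
qed

sublocale M: real_distribution "interval_measure G"
  by (rule real_distribution_G)

sublocale M: cdf_distribution "interval_measure G"
  by unfold_locales

lemma distr_quantile: "distr unif borel (quantile G) = interval_measure G"
  using M.distr_I_eq_M unfolding quantile_def[abs_def] cdf_G .

lemma measurable_quantile [measurable]: "quantile G \<in> borel_measurable unif"
proof -
  have "quantile G \<in> borel_measurable (restrict_space borel {0<..<1})"
    by (intro borel_measurable_mono_on_fnc mono_onI quantile_mono) auto
  then show ?thesis
    by (simp add: measurable_cong_sets[OF sets_restrict_space_cong[OF sets_lborel] refl])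
qed

lemma quantile_range: "u \<in> {0<..<1} \<Longrightarrow> quantile G u \<in> {0..1}"
  using quantile_bounds[of u] by auto

text \<open>Monotonicity and boundedness of \<open>pos_vv G\<close> are known on [0, 1] only. The
  value 0 elsewhere yields a Borel function on the line, and signals lie elsewhere with probability
  0.\<close>

definition clipped_vv :: "real \<Rightarrow> real" where
  "clipped_vv x = (if x \<in> {0..1} then pos_vv G x else 0)"

lemma measurable_clipped_vv [measurable]: "clipped_vv \<in> borel_measurable borel"
proof -
  have "pos_vv G \<in> borel_measurable (restrict_space borel {0..1})"
    by (intro borel_measurable_mono_on_fnc mono_onI pos_vv_mono) auto
  then show ?thesis
    unfolding clipped_vv_def[abs_def] by (subst (asm) measurable_restrict_space_iff[where c = 0]) auto
qed

lemma clipped_vv_bounds: "0 \<le> clipped_vv x" "clipped_vv x \<le> 1"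
  by (auto simp: clipped_vv_def pos_vv_bounds)

lemma measurable_vv_quantile [measurable]: "(\<lambda>u. pos_vv G (quantile G u)) \<in> borel_measurable unif"
proof -
  have "(\<lambda>u. clipped_vv (quantile G u)) \<in> borel_measurable unif"
    by measurable
  then show ?thesis
    by (rule measurable_cong[THEN iffD1, rotated]) (use quantile_range in \<open>auto simp: clipped_vv_def\<close>)
qed

lemma vv_cdf_eq: "vv_cdf G t = measure (interval_measure G) {x. clipped_vv x \<le> t}"
proof -
  have "measure (interval_measure G) {x. clipped_vv x \<le> t}
      = measure unif (quantile G -` {x. clipped_vv x \<le> t} \<inter> space unif)"
    by (subst distr_quantile[symmetric], subst measure_distr) auto
  also have "quantile G -` {x. clipped_vv x \<le> t} \<inter> space unif
      = {u \<in> {0<..<1}. pos_vv G (quantile G u) \<le> t}"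
    using quantile_range by (auto simp: clipped_vv_def)
  finally show ?thesis by (simp add: vv_cdf_def)
qed

lemma vv_cdf_bounds: "vv_cdf G t \<in> {0..1}"
  by (auto simp: vv_cdf_def)

lemma sets_vv_quantile: "{u \<in> {0<..<1}. pos_vv G (quantile G u) \<le> t} \<in> sets unif"
proof -
  have "{u \<in> space unif. pos_vv G (quantile G u) \<le> t} \<in> sets unif" by measurable
  then show ?thesis by simp
qed

lemma measurable_vv_cdf [measurable]: "vv_cdf G \<in> borel_measurable borel"
proof (rule borel_measurable_mono, rule monoI)
  fix s t :: real assume "s \<le> t"
  then show "vv_cdf G s \<le> vv_cdf G t"
    unfolding vv_cdf_def by (intro unif.finite_measure_mono sets_vv_quantile) auto
qed

section \<open>Expected revenue in terms of \<open>vv_cdf\<close>\<close>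

lemma integrable_power: "integrable unif (\<lambda>t. vv_cdf G t ^ n)"
  using vv_cdf_bounds by (intro unif.integrable_const_bound[of _ 1] borel_measurable_unif)
    (auto intro!: AE_I2 power_le_one)

text \<open>The winners are the buyers whose value attains \<open>m\<close>, the largest positive
  part; the top ones share the object equally, so their payments add up to \<open>m\<close>. With no
  winner every value is negative and \<open>m = 0\<close>.\<close>

lemma allocation_sum:
  assumes n: "n \<ge> 1" and x: "x \<in> {1..n} \<rightarrow>\<^sub>E {0..1}"
  shows "(\<Sum>i=1..n. (0 * x i - real_of_ereal (ironed_vv G (x i))) * alloc n G x i)
       = - Max ((\<lambda>i. pos_vv G (x i)) ` {1..n})"
proof -
  define v where "v i = ironed_vv G (x i)" for i
  define m where "m = Max ((\<lambda>j. max (v j) 0) ` {1..n})"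
  define T where "T = top_winners n G x"
  have ne: "{1..n} \<noteq> {}" using n by simp
  have xr: "x i \<in> {0..1}" if "i \<in> {1..n}" for i using x that by auto
  have pv: "ereal (pos_vv G (x i)) = max (v i) 0" if "i \<in> {1..n}" for i
    using ereal_pos_vv[OF xr[OF that]] by (simp add: v_def max.commute)
  have m: "ereal (Max ((\<lambda>i. pos_vv G (x i)) ` {1..n})) = m"
  proof -
    have "ereal (Max ((\<lambda>i. pos_vv G (x i)) ` {1..n})) = Max (ereal ` (\<lambda>i. pos_vv G (x i)) ` {1..n})"
      using ne by (intro mono_Max_commute) (auto intro!: monoI)
    also have "ereal ` (\<lambda>i. pos_vv G (x i)) ` {1..n} = (\<lambda>j. max (v j) 0) ` {1..n}"
      unfolding image_image by (intro image_cong refl pv)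
    finally show ?thesis by (simp add: m_def)
  qed
  have vm: "v i \<le> m" if "i \<in> {1..n}" for i
  proof -
    have "max (v i) 0 \<le> m" unfolding m_def using that by (intro Max_ge) auto
    then show ?thesis by simp
  qed
  have W: "winners n G x = {i \<in> {1..n}. v i = m}"
    using vm by (auto simp: winners_def v_def m_def intro: antisym)
  have T: "T \<subseteq> winners n G x" "finite T"
    by (auto simp: T_def top_winners_def W)
  have "(\<Sum>i=1..n. (0 * x i - real_of_ereal (v i)) * alloc n G x i)
      = (\<Sum>i=1..n. if i \<in> T then - real_of_ereal m / card T else 0)"
    using T by (intro sum.cong) (auto simp: alloc_def T_def[symmetric] W)
  also have "\<dots> = (\<Sum>i\<in>T. - real_of_ereal m / card T)"
  proof -
    have "{1..n} \<inter> T = T" using T by (auto simp: W)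
    then show ?thesis by (subst sum.inter_restrict[symmetric]) simp_all
  qed
  also have "\<dots> = - real_of_ereal m"
  proof (cases "winners n G x = {}")
    case True
    have "m \<in> (\<lambda>j. max (v j) 0) ` {1..n}"
      unfolding m_def using ne by (intro Max_in) auto
    then have "m = 0" using True unfolding W by (auto simp: max_def split: if_splits)
    then show ?thesis by simp
  next
    case False
    have fin: "finite (winners n G x)" by (simp add: W)
    then have "Max (x ` winners n G x) \<in> x ` winners n G x"
      using False by (intro Max_in) auto
    then obtain i where "i \<in> winners n G x" "x i = Max (x ` winners n G x)" by auto
    then have "i \<in> T" using fin by (auto simp: T_def top_winners_def)
    then have "card T > 0" using T(2) card_gt_0_iff by blast
    then show ?thesis by simp
  qed
  also have "real_of_ereal m = Max ((\<lambda>i. pos_vv G (x i)) ` {1..n})"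
    by (simp flip: m)
  finally show ?thesis by (simp add: v_def)
qed

text \<open>Revenue is the expected maximum of \<open>n\<close> independent positive parts. By
  independence that maximum has distribution function \<open>vv_cdf G t ^ n\<close>, and the
  layer-cake formula integrates its tail.\<close>

lemma V_eq:
  assumes n: "n \<ge> 1"
  shows "V n 0 G = (LINT t|unif. vv_cdf G t ^ n) - 1"
proof -
  define P where "P = (\<Pi>\<^sub>M i\<in>{1..n}. interval_measure G)"
  interpret finite_product_prob_space "\<lambda>_. interval_measure G" "{1..n}"
    by unfold_locales simp
  have [simp]: "space P = {1..n} \<rightarrow>\<^sub>E UNIV" by (simp add: P_def space_PiM)
  have prob_P: "prob_space P" unfolding P_def by (rule prob_space_PiM) (rule M.prob_space_axioms)
  interpret P': prob_space P by (rule prob_P)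
  define Z where "Z x = Max ((\<lambda>i. clipped_vv (x i)) ` {1..n})" for x
  have ne: "{1..n} \<noteq> {}" using n by simp
  have Z_meas [measurable]: "Z \<in> borel_measurable P"
  proof -
    have *: "(\<lambda>x. clipped_vv (x i)) \<in> borel_measurable P" if "i \<in> {1..n}" for i
      unfolding P_def using that by measurable
    show ?thesis unfolding Z_def[abs_def]
      using borel_measurable_Max[of "{1..n}" "\<lambda>i x. clipped_vv (x i)" P] * by simp
  qed
  have Z01: "Z x \<in> {0..1}" for x
  proof -
    have "Z x \<in> (\<lambda>i. clipped_vv (x i)) ` {1..n}"
      unfolding Z_def using ne by (intro Max_in) auto
    then show ?thesis using clipped_vv_bounds by auto
  qed
  have AE01: "AE x in P. x \<in> {1..n} \<rightarrow>\<^sub>E {0..1}"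
  proof -
    have "AE x in interval_measure G. x \<in> {0..1}"
      unfolding distr_quantile[symmetric] using quantile_range by (subst AE_distr_iff) (auto intro!: AE_I2)
    then have "AE x in P. x i \<in> {0..1}" if "i \<in> {1..n}" for i
      unfolding P_def using that by (intro AE_PiM_component) (auto intro: M.prob_space_axioms)
    then have "AE x in P. \<forall>i\<in>{1..n}. x i \<in> {0..1}"
      by (intro AE_finite_allI) auto
    then show ?thesis
      by (rule AE_mp) (auto intro!: AE_I2 simp: PiE_def Pi_def)
  qed
  have "V n 0 G = (LINT x|P. indicator ({1..n} \<rightarrow>\<^sub>E {0..1}) x * - Z x)"
    unfolding V_def set_lebesgue_integral_def P_def[symmetric]
  proof (rule Bochner_Integration.integral_cong[OF refl])
    fix x assume "x \<in> space P"
    have "Z x = Max ((\<lambda>i. pos_vv G (x i)) ` {1..n})" if "x \<in> {1..n} \<rightarrow>\<^sub>E {0..1}"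
      unfolding Z_def using that by (intro arg_cong[where f = Max] image_cong) (auto simp: clipped_vv_def)
    then show "indicator ({1..n} \<rightarrow>\<^sub>E {0..1}) x *\<^sub>R
        (\<Sum>i=1..n. (0 * x i - real_of_ereal (ironed_vv G (x i))) * alloc n G x i)
      = indicator ({1..n} \<rightarrow>\<^sub>E {0..1}) x * - Z x"
      using allocation_sum[OF n, of x] by (auto simp: indicator_def)
  qed
  also have "\<dots> = (LINT x|P. - Z x)"
  proof (rule integral_cong_AE)
    have "{1..n} \<rightarrow>\<^sub>E {0..1::real} \<in> sets P" unfolding P_def by (intro sets_PiM_I_finite) auto
    then show "(\<lambda>x. indicator ({1..n} \<rightarrow>\<^sub>E {0..1}) x * - Z x) \<in> borel_measurable P" by measurable
    show "AE x in P. indicator ({1..n} \<rightarrow>\<^sub>E {0..1}) x * - Z x = - Z x"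
      using AE01 by eventually_elim simp
  qed simp
  also have "\<dots> = - (LINT t|unif. measure P {x \<in> space P. t < Z x})"
    using P'.integral_layer_cake[OF Z_meas Z01] by simp
  also have "(LINT t|unif. measure P {x \<in> space P. t < Z x}) = (LINT t|unif. 1 - vv_cdf G t ^ n)"
  proof (rule Bochner_Integration.integral_cong[OF refl])
    fix t :: real
    have le: "{x \<in> space P. Z x \<le> t} = {1..n} \<rightarrow>\<^sub>E {x. clipped_vv x \<le> t}"
      using ne by (auto simp: Z_def PiE_def Pi_def)
    have sets_le: "{x \<in> space P. Z x \<le> t} \<in> sets P" by measurable
    have "{x \<in> space P. t < Z x} = space P - {x \<in> space P. Z x \<le> t}" by auto
    then have "measure P {x \<in> space P. t < Z x} = 1 - measure P {x \<in> space P. Z x \<le> t}"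
      using P'.prob_compl[OF sets_le] by (simp only:)
    also have "measure P {x \<in> space P. Z x \<le> t} = vv_cdf G t ^ n"
      unfolding le vv_cdf_eq unfolding P_def by (subst finite_measure_PiM_emb) auto
    finally show "measure P {x \<in> space P. t < Z x} = 1 - vv_cdf G t ^ n" .
  qed
  also have "\<dots> = 1 - (LINT t|unif. vv_cdf G t ^ n)"
    using integrable_power unif.prob_space by (simp del: space_unif)
  finally show ?thesis by simp
qed

section \<open>Bounds on the quantile function and on the mean\<close>

lemma mean_eq: "(LINT x:{0..1}|interval_measure G. x) = (LINT u|unif. quantile G u)"
proof -
  have "(LINT x:{0..1}|interval_measure G. x)
      = (LINT u|unif. indicator {0..1} (quantile G u) *\<^sub>R quantile G u)"
    unfolding set_lebesgue_integral_def
    by (subst distr_quantile[symmetric], subst integral_distr) auto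
  also have "\<dots> = (LINT u|unif. quantile G u)"
    using quantile_range by (intro Bochner_Integration.integral_cong) auto
  finally show ?thesis .
qed

text \<open>An average over \<open>t\<close> of the functions in \<open>integral_min_ratio\<close>
  with \<open>h = vv_cdf G t\<close>, evaluated at \<open>q\<close>.\<close>

definition quantile_bound :: "real \<Rightarrow> real" where
  "quantile_bound q = (LINT t|unif. min 1 ((1 - vv_cdf G t) / (1 - q)))"

text \<open>The tail mass \<^term>\<open>{u. q < u \<and> t < pos_vv G (quantile G u)}\<close> is at most the mass of either condition.\<close>

lemma quantile_le_bound:
  assumes q: "q \<in> {0<..<1}" shows "quantile G q \<le> quantile_bound q"
proof -
  define f where "f u = pos_vv G (quantile G u)" for u
  have f01: "0 \<le> f u" "f u \<le> 1" if "u \<in> {0<..<1}" for u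
    unfolding f_def using quantile_range[OF that] by (simp_all add: pos_vv_bounds)
  have [measurable]: "f \<in> borel_measurable unif"
    unfolding f_def[abs_def] by (rule measurable_vv_quantile)
  have meas: "(\<lambda>u. indicator {q<..} u * f u) \<in> borel_measurable unif"
  proof -
    note [measurable] = measurable_ident_unif
    show ?thesis by measurable
  qed
  have int: "integrable unif (\<lambda>t. min 1 ((1 - vv_cdf G t) / (1 - q)))"
    using min_ratio_bounds[OF vv_cdf_bounds] q
    by (intro unif.integrable_const_bound[of _ 1] borel_measurable_unif) (auto intro!: AE_I2)
  have "(1 - q) * quantile G q \<le> integral {q..1} f"
    unfolding f_def using q by (intro quantile_revenue_le) auto
  also have "\<dots> = (LINT u|unif. indicator {q<..} u * f u)"
    using q f01 by (intro integral_unif_eq_HK[symmetric, of _ 1]) auto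
  also have "\<dots> = (LINT t|unif. measure unif {u \<in> space unif. t < indicator {q<..} u * f u})"
    using f01 by (intro unif.integral_layer_cake[OF meas]) (auto simp: indicator_def)
  also have "\<dots> \<le> (LINT t|unif. (1 - q) * min 1 ((1 - vv_cdf G t) / (1 - q)))"
  proof (rule integral_mono_AE)
    show "integrable unif (\<lambda>t. (1 - q) * min 1 ((1 - vv_cdf G t) / (1 - q)))"
      using int by simp
    have bnd: "measure unif {u \<in> space unif. t < indicator {q<..} u * f u} \<le> (1 - q) * min 1 ((1 - vv_cdf G t) / (1 - q))"
      if "t \<in> {0<..<1}" for t
    proof -
      let ?A = "{u \<in> space unif. t < indicator {q<..} u * f u}"
      have sets: "{u \<in> space unif. t < f u} \<in> sets unif" "{u \<in> space unif. f u \<le> t} \<in> sets unif"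
        by measurable
      have "measure unif ?A \<le> measure unif {q<..<1}"
        using that q by (intro unif.finite_measure_mono) (auto simp: indicator_def sets_restrict_space_iff split: if_splits)
      then have 1: "measure unif ?A \<le> 1 - q" using q by (simp add: measure_unif_Ioo)
      have "measure unif ?A \<le> measure unif {u \<in> space unif. t < f u}"
        using that sets by (intro unif.finite_measure_mono) (auto simp: indicator_def split: if_splits)
      also have "{u \<in> space unif. t < f u} = space unif - {u \<in> space unif. f u \<le> t}" by auto
      also have "measure unif \<dots> = 1 - vv_cdf G t"
        using sets(2) by (subst unif.prob_compl) (auto simp: vv_cdf_def f_def)
      finally have 2: "measure unif ?A \<le> 1 - vv_cdf G t" .
      show ?thesis using 1 2 q by (auto simp: min_def)
    qed
    then show "AE t in unif. measure unif {u \<in> space unif. t < indicator {q<..} u * f u}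
        \<le> (1 - q) * min 1 ((1 - vv_cdf G t) / (1 - q))"
      by (intro AE_I2) simp
    have sets: "{u \<in> space unif. t < indicator {q<..} u * f u} \<in> sets unif" for t
      using meas by measurable
    \<comment> \<open>Monotonicity in \<open>t\<close> supplies the measurability.\<close>
    have "antimono (\<lambda>t. measure unif {u \<in> space unif. t < indicator {q<..} u * f u})"
    proof (rule antimonoI)
      fix s t :: real assume "s \<le> t"
      then show "measure unif {u \<in> space unif. t < indicator {q<..} u * f u}
          \<le> measure unif {u \<in> space unif. s < indicator {q<..} u * f u}"
        using sets[of s] by (intro unif.finite_measure_mono) auto
    qed
    then have "mono (\<lambda>t. - measure unif {u \<in> space unif. t < indicator {q<..} u * f u})"
      by (auto simp: antimono_def mono_def)
    then have "(\<lambda>t. - measure unif {u \<in> space unif. t < indicator {q<..} u * f u}) \<in> borel_measurable borel"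
      by (rule borel_measurable_mono)
    then have "(\<lambda>t. measure unif {u \<in> space unif. t < indicator {q<..} u * f u}) \<in> borel_measurable borel"
      by (simp only: borel_measurable_uminus_eq)
    then have "(\<lambda>t. measure unif {u \<in> space unif. t < indicator {q<..} u * f u}) \<in> borel_measurable unif"
      by (rule borel_measurable_unif)
    then show "integrable unif (\<lambda>t. measure unif {u \<in> space unif. t < indicator {q<..} u * f u})"
      by (intro unif.integrable_const_bound[of _ 1]) (auto intro!: AE_I2)
  qed
  also have "\<dots> = (1 - q) * quantile_bound q"
    by (simp add: quantile_bound_def)
  finally show ?thesis using q by simp
qed

lemma integrable_mean_gap: "integrable unif (\<lambda>t. mean_gap (vv_cdf G t))"
proof (rule unif.integrable_const_bound[of _ 1])
  show "AE t in unif. norm (mean_gap (vv_cdf G t)) \<le> 1"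
    using mean_gap_bounds[OF vv_cdf_bounds] by (intro AE_I2) simp
  show "(\<lambda>t. mean_gap (vv_cdf G t)) \<in> borel_measurable unif"
    unfolding mean_gap_def by (rule borel_measurable_unif) measurable
qed

text \<open>Fubini: for fixed \<open>t\<close>, the inner integral over \<open>q\<close> is given by
  \<open>integral_min_ratio\<close>.\<close>

lemma integral_quantile_bound:
  "(LINT q|unif. quantile_bound q) = 1 - (LINT t|unif. mean_gap (vv_cdf G t))"
  and measurable_quantile_bound [measurable]: "quantile_bound \<in> borel_measurable unif"
proof -
  interpret pair_prob_space unif unif
    by (simp add: pair_prob_space_def pair_sigma_finite_def prob_space_unif
        unif.sigma_finite_measure_axioms)
  have meas: "(\<lambda>(q, t). min 1 ((1 - vv_cdf G t) / (1 - q))) \<in> borel_measurable (unif \<Otimes>\<^sub>M unif)"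
  proof -
    have [measurable]: "vv_cdf G \<in> borel_measurable unif"
      by (rule borel_measurable_unif) measurable
    note [measurable] = measurable_ident_unif
    show ?thesis by measurable
  qed
  then show "quantile_bound \<in> borel_measurable unif"
    unfolding quantile_bound_def[abs_def] by (intro unif.borel_measurable_lebesgue_integral) auto
  have int: "integrable (unif \<Otimes>\<^sub>M unif) (\<lambda>(q, t). min 1 ((1 - vv_cdf G t) / (1 - q)))"
    using min_ratio_bounds[OF vv_cdf_bounds] meas
    by (intro P.integrable_const_bound[of _ 1]) (auto intro!: AE_I2 simp: space_pair_measure)
  have "(LINT q|unif. quantile_bound q) = (LINT t|unif. LINT q|unif. min 1 ((1 - vv_cdf G t) / (1 - q)))"
    unfolding quantile_bound_def using Fubini_integral[OF int] by simp
  also have "\<dots> = (LINT t|unif. 1 - mean_gap (vv_cdf G t))"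
    using vv_cdf_bounds by (intro Bochner_Integration.integral_cong refl integral_min_ratio) auto
  also have "\<dots> = 1 - (LINT t|unif. mean_gap (vv_cdf G t))"
    using integrable_mean_gap unif.prob_space by (simp del: space_unif)
  finally show "(LINT q|unif. quantile_bound q) = 1 - (LINT t|unif. mean_gap (vv_cdf G t))" .
qed

lemma integrable_quantile_bound: "integrable unif quantile_bound"
proof (rule unif.integrable_const_bound[of _ 1])
  have "\<bar>quantile_bound q\<bar> \<le> 1" if q: "q \<in> {0<..<1}" for q
  proof -
    have r: "0 \<le> min 1 ((1 - vv_cdf G t) / (1 - q))" for t
      using q vv_cdf_bounds[of t] by simp
    then have "0 \<le> quantile_bound q"
      unfolding quantile_bound_def by (intro integral_nonneg_AE AE_I2)
    moreover have "quantile_bound q \<le> (LINT t|unif. 1)"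
      unfolding quantile_bound_def
      by (intro integral_mono_AE unif.integrable_const_bound[of _ 1] AE_I2 borel_measurable_unif)
         (use r in auto)
    ultimately show ?thesis using unif.prob_space by (simp del: space_unif)
  qed
  then show "AE q in unif. norm (quantile_bound q) \<le> 1" by (intro AE_I2) simp
qed measurable

end

section \<open>Optimality and uniqueness of the truncated Pareto distribution\<close>

text \<open>The quantile function carries \<open>unif\<close> to the law of the signal, and the law
  determines its CDF.\<close>

lemma signal_cdf_eqI:
  assumes "signal_cdf G" "signal_cdf G'" "AE u in unif. quantile G u = quantile G' u"
  shows "G = G'"
proof -
  interpret G: signal_cdf G by fact
  interpret G': signal_cdf G' by fact
  have "interval_measure G = interval_measure G'"
    unfolding G.distr_quantile[symmetric] G'.distr_quantile[symmetric]
    using assms(3) by (intro distr_cong_AE) auto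
  then show ?thesis using G.cdf_G G'.cdf_G by metis
qed

text \<open>The quantile function of the truncated Pareto law, by \<open>quantile_pareto\<close>. It
  averages \<open>min 1 ((1 - h) / (1 - u))\<close> over \<open>h = 0\<close> with weight
  \<open>k\<close> and \<open>h = q\<close> with weight \<open>1 - k\<close>.\<close>

definition pareto_quantile :: "real \<Rightarrow> real \<Rightarrow> real \<Rightarrow> real" where
  "pareto_quantile k q u = 1 - (1 - k) * (1 - min 1 ((1 - q) / (1 - u)))"

lemma integrable_min_ratio:
  assumes "q \<in> {0..1}" shows "integrable unif (\<lambda>u. min 1 ((1 - q) / (1 - u)))"
  using min_ratio_bounds[OF assms]
  by (intro unif.integrable_const_bound[of _ 1] borel_measurable_unif) (auto intro!: AE_I2)

lemma integral_pareto_quantile: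
  assumes "q \<in> {0..1}" shows "(LINT u|unif. pareto_quantile k q u) = 1 - (1 - k) * mean_gap q"
  using integral_min_ratio[of q] integrable_min_ratio[of q] assms unif.prob_space
  by (simp add: pareto_quantile_def del: space_unif)

context signal_cdf
begin

section \<open>Weak duality and its equality case\<close>

lemma integrable_quantile: "integrable unif (quantile G)"
  using quantile_range by (intro unif.integrable_const_bound[of _ 1]) (auto intro!: AE_I2)

lemma mean_le:
  shows "(LINT u|unif. quantile G u) \<le> 1 - (LINT t|unif. mean_gap (vv_cdf G t))"
  unfolding integral_quantile_bound[symmetric]
  using quantile_le_bound
  by (intro integral_mono_AE integrable_quantile integrable_quantile_bound AE_I2) simp

context
  fixes n p q k l v
  assumes n: "n \<ge> 1" and mult: "pareto_multipliers n p q k l v"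
    and mean: "(LINT u|unif. quantile G u) = p"
begin

lemma Lagrangian_gap:
  "(LINT t|unif. l * mean_gap (vv_cdf G t) + v - vv_cdf G t ^ n)
     = l * (LINT t|unif. mean_gap (vv_cdf G t)) + v - (LINT t|unif. vv_cdf G t ^ n)"
  using integrable_mean_gap integrable_power unif.prob_space by (simp del: space_unif)

lemma Lagrangian_gap_nonneg: "0 \<le> l * mean_gap (vv_cdf G t) + v - vv_cdf G t ^ n"
  using mult vv_cdf_bounds[of t] unfolding pareto_multipliers_def by fastforce

text \<open>There is no duality gap: \<open>v * k = 0\<close> identifies the dual value with the
  objective of the certified function.\<close>

lemma optimum_eq: "(1 - k) * q ^ n = l * (1 - p) + v"
proof -
  have "(1 - k) * q ^ n = l * ((1 - k) * mean_gap q) + v - v * k"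
    using mult by (simp add: pareto_multipliers_def algebra_simps)
  then show ?thesis using mult by (simp add: pareto_multipliers_def)
qed

text \<open>Weak duality: integrate the pointwise bound on \<open>vv_cdf G t ^ n\<close> and apply
  \<open>mean_le\<close>.\<close>

lemma V_le: "V n 0 G \<le> (1 - k) * q ^ n - 1"
proof -
  have "0 \<le> (LINT t|unif. l * mean_gap (vv_cdf G t) + v - vv_cdf G t ^ n)"
    using Lagrangian_gap_nonneg by (intro integral_nonneg_AE AE_I2)
  moreover have "l * (LINT t|unif. mean_gap (vv_cdf G t)) \<le> l * (1 - p)"
    using mean_le mult by (intro mult_left_mono) (auto simp: pareto_multipliers_def mean)
  ultimately show ?thesis
    unfolding Lagrangian_gap V_eq[OF n] optimum_eq by simp
qed

text \<open>Equality makes both inequalities behind \<open>V_le\<close> tight. So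
  \<open>vv_cdf G\<close> takes only the values 0 and \<open>q\<close> almost everywhere, which
  determines \<open>quantile_bound\<close>; having the same mean \<open>p\<close>,
  \<open>quantile G\<close> agrees with it almost everywhere.\<close>

lemma quantile_of_maximizer:
  assumes eq: "V n 0 G = (1 - k) * q ^ n - 1"
  shows "AE u in unif. quantile G u = pareto_quantile k q u"
proof -
  have l: "l > 0" and q: "0 < q" "q < 1" and k: "(1 - k) * mean_gap q = 1 - p"
    using mult by (auto simp: pareto_multipliers_def)
  have 1: "0 \<le> (LINT t|unif. l * mean_gap (vv_cdf G t) + v - vv_cdf G t ^ n)"
    using Lagrangian_gap_nonneg by (intro integral_nonneg_AE AE_I2)
  have 2: "l * (LINT t|unif. mean_gap (vv_cdf G t)) \<le> l * (1 - p)"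
    using mean_le l by (intro mult_left_mono) (auto simp: mean)
  have 3: "(LINT t|unif. vv_cdf G t ^ n) = l * (1 - p) + v"
    using eq unfolding V_eq[OF n] optimum_eq by simp
  have "l * (LINT t|unif. mean_gap (vv_cdf G t)) = l * (1 - p)"
    using 1 2 3 unfolding Lagrangian_gap by linarith
  with l have gap: "(LINT t|unif. mean_gap (vv_cdf G t)) = 1 - p" by simp
  have "(LINT t|unif. l * mean_gap (vv_cdf G t) + v - vv_cdf G t ^ n) = 0"
    unfolding Lagrangian_gap using 3 gap by simp
  moreover have "integrable unif (\<lambda>t. l * mean_gap (vv_cdf G t) + v - vv_cdf G t ^ n)"
    using integrable_mean_gap integrable_power by simp
  ultimately have "AE t in unif. l * mean_gap (vv_cdf G t) + v - vv_cdf G t ^ n = 0"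
    using integral_nonneg_eq_0_iff_AE[of unif] Lagrangian_gap_nonneg by force
  then have vals: "AE t in unif. vv_cdf G t = 0 \<or> vv_cdf G t = q"
  proof eventually_elim
    case (elim t)
    then have "vv_cdf G t ^ n = l * mean_gap (vv_cdf G t) + v" by simp
    then show ?case using mult vv_cdf_bounds[of t] unfolding pareto_multipliers_def by blast
  qed
  have bound: "quantile_bound u = pareto_quantile k q u" if u: "u \<in> {0<..<1}" for u
  proof -
    \<comment> \<open>At the values 0 and \<open>q\<close> the integrand of
      \<open>quantile_bound\<close> coincides with an affine function of \<open>mean_gap\<close>,
      whose integral is known from \<open>gap\<close>.\<close>
    let ?c = "(1 - min 1 ((1 - q) / (1 - u))) / mean_gap q"
    have "quantile_bound u = (LINT t|unif. 1 - ?c * mean_gap (vv_cdf G t))"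
      unfolding quantile_bound_def
    proof (rule integral_cong_AE)
      show "AE t in unif. min 1 ((1 - vv_cdf G t) / (1 - u)) = 1 - ?c * mean_gap (vv_cdf G t)"
        using vals by eventually_elim (use u q mean_gap_pos[of q] in auto)
      show "(\<lambda>t. 1 - ?c * mean_gap (vv_cdf G t)) \<in> borel_measurable unif"
        using borel_measurable_integrable[OF integrable_mean_gap] by simp
    qed (rule borel_measurable_unif, measurable)
    also have "\<dots> = 1 - ?c * (1 - p)"
      using integrable_mean_gap gap unif.prob_space by (simp del: space_unif)
    also have "\<dots> = pareto_quantile k q u"
      unfolding pareto_quantile_def k[symmetric] using mean_gap_pos[of q] q by simp
    finally show ?thesis .
  qed
  have "(LINT u|unif. quantile_bound u - quantile G u) = 0"
    using integrable_quantile integrable_quantile_bound mean gap by (simp add: integral_quantile_bound)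
  moreover have "integrable unif (\<lambda>u. quantile_bound u - quantile G u)"
    using integrable_quantile integrable_quantile_bound by simp
  moreover have "AE u in unif. 0 \<le> quantile_bound u - quantile G u"
    using quantile_le_bound by (intro AE_I2) simp
  ultimately have "AE u in unif. quantile_bound u - quantile G u = 0"
    using integral_nonneg_eq_0_iff_AE by blast
  moreover have "AE u in unif. u \<in> {0<..<1}" by (intro AE_I2) simp
  ultimately show ?thesis
    by eventually_elim (use bound in force)
qed

end

end

section \<open>The truncated Pareto distribution attains the bound\<close>

context
  fixes k q :: real
  assumes k: "0 \<le> k" "k < 1" and q: "0 < q" "q < 1"
begin

text \<open>Chosen so that the CDF has left limit \<open>q\<close> at 1, leaving an atom of mass
  \<open>1 - q\<close> there.\<close>

definition pareto_start :: real where "pareto_start = k + (1 - k) * (1 - q)"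

abbreviation pareto_cdf :: "real \<Rightarrow> real" where "pareto_cdf \<equiv> trunc_pareto k pareto_start"

lemma pareto_start_bounds: "k < pareto_start" "0 < pareto_start" "pareto_start < 1"
proof -
  have "0 < (1 - k) * (1 - q)" "(1 - k) * (1 - q) < 1 - k"
    using k q mult_strict_left_mono[of "1 - q" 1 "1 - k"] by auto
  then show "k < pareto_start" "0 < pareto_start" "pareto_start < 1"
    using k unfolding pareto_start_def by linarith+
qed

lemma cdf01_pareto: "cdf01 pareto_cdf"
proof -
  note s = pareto_start_bounds
  have "mono pareto_cdf"
  proof (rule monoI)
    fix x y :: real assume "x \<le> y"
    moreover have "(pareto_start - k) / (y - k) \<le> (pareto_start - k) / (x - k)" if "pareto_start \<le> x" "x \<le> y"
      using that s by (intro divide_left_mono mult_pos_pos) auto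
    moreover have "(pareto_start - k) / (z - k) \<le> 1" "0 \<le> (pareto_start - k) / (z - k)" if "pareto_start \<le> z" for z
      using that s by (auto simp: divide_le_eq)
    ultimately show "pareto_cdf x \<le> pareto_cdf y"
      using s by (auto simp: trunc_pareto_def)
  qed
  moreover have "continuous (at_right x) pareto_cdf" for x
  proof -
    consider "x < pareto_start" | "pareto_start \<le> x" "x < 1" | "1 \<le> x" by linarith
    then show ?thesis
    proof cases
      case 1
      have "eventually (\<lambda>y. y \<in> {x<..<pareto_start}) (at_right x)"
        using 1 by (rule eventually_at_right_real)
      then have "eventually (\<lambda>y. 0 = pareto_cdf y) (at_right x)"
        by eventually_elim (use s in \<open>auto simp: trunc_pareto_def\<close>)
      then show ?thesis
        unfolding continuous_within using 1 s
        by (auto simp: trunc_pareto_def intro: Lim_transform_eventually[OF tendsto_const])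
    next
      case 2
      have "((\<lambda>y. 1 - (pareto_start - k) / (y - k)) \<longlongrightarrow> 1 - (pareto_start - k) / (x - k)) (at_right x)"
        using 2 s by (intro tendsto_intros) auto
      moreover have "eventually (\<lambda>y. y \<in> {x<..<1}) (at_right x)"
        using 2(2) by (rule eventually_at_right_real)
      then have "eventually (\<lambda>y. 1 - (pareto_start - k) / (y - k) = pareto_cdf y) (at_right x)"
        by eventually_elim (use 2 s in \<open>auto simp: trunc_pareto_def\<close>)
      ultimately show ?thesis
        unfolding continuous_within using 2 s
        by (auto simp: trunc_pareto_def intro: Lim_transform_eventually)
    next
      case 3
      have "eventually (\<lambda>y. y \<in> {x<..<x+1}) (at_right x)"
        by (rule eventually_at_right_real) simp
      then have "eventually (\<lambda>y. 1 = pareto_cdf y) (at_right x)"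
        by eventually_elim (use 3 s in \<open>auto simp: trunc_pareto_def\<close>)
      then show ?thesis
        unfolding continuous_within using 3 s
        by (auto simp: trunc_pareto_def intro: Lim_transform_eventually[OF tendsto_const])
    qed
  qed
  ultimately show ?thesis
    using s by (auto simp: cdf01_def trunc_pareto_def)
qed

interpretation signal_cdf pareto_cdf
  by (rule signal_cdf.intro) (rule cdf01_pareto)

text \<open>Solving \<open>u \<le> pareto_cdf x\<close> for \<open>x\<close> shows, through
  \<open>quantile_le_iff\<close>, that both sides have the same upper bounds.\<close>

lemma quantile_pareto:
  assumes u: "u \<in> {0<..<1}" shows "quantile pareto_cdf u = pareto_quantile k q u"
proof -
  note s = pareto_start_bounds
  have sk: "pareto_start - k = (1 - k) * (1 - q)" by (simp add: pareto_start_def)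
  have Q1: "pareto_quantile k q u \<le> 1"
    using k by (simp add: pareto_quantile_def)
  have Qs: "pareto_start \<le> pareto_quantile k q u"
  proof -
    define m where "m = min 1 ((1 - q) / (1 - u))"
    have "(1 - q) * (1 - u) \<le> 1 - q" using q u mult_left_mono[of "1 - u" 1 "1 - q"] by simp
    then have "1 - q \<le> m"
      using q u by (simp add: m_def pos_le_divide_eq)
    then have "(1 - k) * (1 - q) \<le> (1 - k) * m"
      using k by (intro mult_left_mono) auto
    then show ?thesis
      by (simp add: pareto_quantile_def pareto_start_def m_def[symmetric] algebra_simps)
  qed
  have iff: "u \<le> pareto_cdf x \<longleftrightarrow> pareto_quantile k q u \<le> x" for x
  proof -
    consider "x < pareto_start" | "pareto_start \<le> x" "x < 1" | "1 \<le> x" by linarith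
    then show ?thesis
    proof cases
      case 1
      then show ?thesis using Qs u by (simp add: trunc_pareto_def)
    next
      case 2
      then have "x - k > 0" using s by simp
      have "u \<le> pareto_cdf x \<longleftrightarrow> (pareto_start - k) / (x - k) \<le> 1 - u"
        using 2 by (auto simp: trunc_pareto_def)
      also have "\<dots> \<longleftrightarrow> (1 - k) * ((1 - q) / (1 - u)) \<le> x - k"
        using \<open>x - k > 0\<close> u unfolding sk by (simp add: field_simps)
      also have "\<dots> \<longleftrightarrow> (1 - k) * min 1 ((1 - q) / (1 - u)) \<le> x - k"
      proof (cases "(1 - q) / (1 - u) \<le> 1")
        \<comment> \<open>For a ratio above 1 both inequalities fail, since
          \<open>x - k < 1 - k\<close>.\<close>
        case False
        then have "(1 - k) * 1 \<le> (1 - k) * ((1 - q) / (1 - u))"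
          using k by (intro mult_left_mono) auto
        with False 2 show ?thesis by auto
      qed simp
      also have "\<dots> \<longleftrightarrow> pareto_quantile k q u \<le> x"
        by (simp add: pareto_quantile_def algebra_simps)
      finally show ?thesis .
    next
      case 3
      then show ?thesis using Q1 u s by (auto simp: trunc_pareto_def)
    qed
  qed
  have "quantile pareto_cdf u \<le> x \<longleftrightarrow> pareto_quantile k q u \<le> x" for x
    unfolding iff[symmetric] using u by (intro quantile_le_iff) auto
  then show ?thesis by (meson antisym order_refl)
qed

lemma feasible_pareto:
  assumes "(1 - k) * mean_gap q = 1 - p" shows "feasible p pareto_cdf"
proof -
  have "(LINT u|unif. quantile pareto_cdf u) = (LINT u|unif. pareto_quantile k q u)"
    by (intro Bochner_Integration.integral_cong quantile_pareto) auto
  then show ?thesis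
    using integral_pareto_quantile[of q k] assms q cdf01_pareto by (simp add: feasible_def mean_eq)
qed

text \<open>Between \<open>pareto_start\<close> and 1 the curve \<open>Psi\<close> equals
  \<open>k\<close> times the CDF, and nowhere on [0, 1] does it fall below this line. So the line is
  a minorant that is tight at \<open>x\<close>.\<close>

lemma k_subgradient:
  assumes x: "pareto_start \<le> x" "x < 1" shows "k \<in> subgradients pareto_cdf x"
proof -
  note s = pareto_start_bounds
  have pos: "pareto_cdf x > 0" if "pareto_start < x" for x
    using that s by (auto simp: trunc_pareto_def divide_less_eq)
  \<comment> \<open>The CDF is 0 at \<open>pareto_start\<close> itself, so the infimum is approached
    from the right.\<close>
  have le: "lower_end pareto_cdf = pareto_start"
  proof (rule antisym)
    show "lower_end pareto_cdf \<le> pareto_start"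
    proof (rule dense_ge)
      fix y assume y: "pareto_start < y"
      have "lower_end pareto_cdf \<le> min y 1"
        using pos[of "min y 1"] y s by (intro lower_end_le) auto
      then show "lower_end pareto_cdf \<le> y" by simp
    qed
    show "pareto_start \<le> lower_end pareto_cdf"
      unfolding lower_end_def using s
      by (intro cInf_greatest) (auto simp: trunc_pareto_def intro!: exI[of _ 1] split: if_splits)
  qed
  have psi: "Psi pareto_cdf x = k * pareto_cdf x" if "pareto_start \<le> x" "x < 1" for x
  proof -
    have "x - k > 0" using that s by simp
    then show ?thesis using that by (simp add: Psi_def le trunc_pareto_def field_simps)
  qed
  have "k * pareto_cdf z \<le> Psi pareto_cdf z" if z: "z \<in> {0..1}" for z
  proof -
    consider "z < pareto_start" | "pareto_start \<le> z" "z < 1" | "z = 1"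
      using z by force
    then show ?thesis
    proof cases
      case 1
      then show ?thesis by (simp add: Psi_def le trunc_pareto_def)
    next
      case 2
      then show ?thesis by (simp add: psi)
    next
      case 3
      then show ?thesis using s by (simp add: Psi_def le trunc_pareto_def)
    qed
  qed
  then have minor: "(0, k) \<in> affine_minorants pareto_cdf"
    by (auto simp: affine_minorants_def)
  have "Phi pareto_cdf x \<le> k * pareto_cdf x"
    using Phi_le_Psi[of x] psi[OF x] x s by simp
  moreover have "k * pareto_cdf z \<le> Phi pareto_cdf z" if "z \<in> {0..1}" for z
    using minorant_le_Phi[OF minor that] by simp
  ultimately show ?thesis
    unfolding subgradients_def by (force simp: right_diff_distrib)
qed

text \<open>A lower bound on \<open>vv_cdf\<close> suffices, as \<open>V_le\<close> gives the
  converse. Quantiles at levels \<open>u < q\<close> lie below the atom at 1, where the virtual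
  value is at most \<open>k\<close>.\<close>

lemma V_pareto_ge:
  assumes n: "n \<ge> 1" shows "(1 - k) * q ^ n - 1 \<le> V n 0 pareto_cdf"
proof -
  note s = pareto_start_bounds
  have H: "q \<le> vv_cdf pareto_cdf t" if t: "k \<le> t" for t
  proof -
    have "pos_vv pareto_cdf (quantile pareto_cdf u) \<le> t" if u: "u \<in> {0<..<q}" for u
    proof -
      have u1: "u \<in> {0<..<1}" using u q by auto
      have "(1 - q) / (1 - u) < 1" using u q by (simp add: divide_less_eq)
      then have "0 < (1 - k) * (1 - min 1 ((1 - q) / (1 - u)))"
        using k by (intro mult_pos_pos) auto
      then have lt: "quantile pareto_cdf u < 1"
        by (simp add: quantile_pareto[OF u1] pareto_quantile_def)
      \<comment> \<open>\<open>k_subgradient\<close> asks for a point not below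
        \<open>pareto_start\<close>; monotonicity transfers its bound to the quantile.\<close>
      define y where "y = max pareto_start (quantile pareto_cdf u)"
      have y: "pareto_start \<le> y" "y < 1" "y \<in> {0..1}" using lt s by (auto simp: y_def)
      have "pos_vv pareto_cdf (quantile pareto_cdf u) \<le> pos_vv pareto_cdf y"
        using quantile_range[OF u1] y by (intro pos_vv_mono) (auto simp: y_def)
      also have "\<dots> \<le> k"
        using k_subgradient[OF y(1,2)] y(3) k by (intro pos_vv_le) auto
      finally show ?thesis using t by simp
    qed
    then have "measure unif {0<..<q} \<le> vv_cdf pareto_cdf t"
      unfolding vv_cdf_def using q by (intro unif.finite_measure_mono sets_vv_quantile) auto
    then show ?thesis using q by (simp add: measure_unif_Ioo)
  qed
  have sets: "{k<..<1} \<in> sets unif"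
    using k by (auto simp: sets_restrict_space_iff)
  have "(1 - k) * q ^ n = (LINT t|unif. q ^ n * indicator {k<..<1} t)"
    using k sets measure_unif_Ioo[of k 1]
    by (simp add: Bochner_Integration.integral_indicator Int_absorb2 greaterThanLessThan_subseteq_greaterThanLessThan)
  also have "\<dots> \<le> (LINT t|unif. vv_cdf pareto_cdf t ^ n)"
  proof (rule integral_mono_AE)
    show "integrable unif (\<lambda>t. vv_cdf pareto_cdf t ^ n)"
      by (rule integrable_power)
    show "integrable unif (\<lambda>t. q ^ n * indicator {k<..<1} t)"
      using sets by (auto intro!: integrable_real_indicator simp: unif.emeasure_eq_measure)
    show "AE t in unif. q ^ n * indicator {k<..<1} t \<le> vv_cdf pareto_cdf t ^ n"
      using H q vv_cdf_bounds by (intro AE_I2) (auto simp: indicator_def intro!: power_mono)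
  qed
  finally show ?thesis by (simp add: V_eq[OF n])
qed

end

text \<open>The two bounds make the value of \<open>Gs\<close> the maximum. Every maximizer then
  shares its quantile function almost everywhere, hence equals \<open>Gs\<close>.\<close>

lemma seller_worst_iff_pareto:
  assumes n: "n \<ge> 1" and mult: "pareto_multipliers n p q k l v"
  shows "seller_worst n p G \<longleftrightarrow> G = trunc_pareto k (pareto_start k q)"
proof -
  have kq: "0 \<le> k" "k < 1" "0 < q" "q < 1" "(1 - k) * mean_gap q = 1 - p"
    using mult by (auto simp: pareto_multipliers_def)
  define Gs where "Gs = trunc_pareto k (pareto_start k q)"
  have Gs: "feasible p Gs" "(1 - k) * q ^ n - 1 \<le> V n 0 Gs"
    unfolding Gs_def using feasible_pareto[of k q p] V_pareto_ge[of k q n] kq n by auto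
  have cdf: "signal_cdf G" if "feasible p G" for G
    using that by (simp add: feasible_def signal_cdf_def)
  have mean: "(LINT u|unif. quantile G u) = p" if "feasible p G" for G
    using that signal_cdf.mean_eq[OF cdf[OF that]] by (simp add: feasible_def)
  have le: "V n 0 G \<le> (1 - k) * q ^ n - 1" if "feasible p G" for G
    using signal_cdf.V_le[OF cdf[OF that] n mult mean[OF that]] .
  have Gs_eq: "V n 0 Gs = (1 - k) * q ^ n - 1"
    using Gs le by (intro antisym) auto
  have unique: "G = Gs" if G: "feasible p G" "V n 0 G = (1 - k) * q ^ n - 1" for G
  proof (rule signal_cdf_eqI)
    show "AE u in unif. quantile G u = quantile Gs u"
      using signal_cdf.quantile_of_maximizer[OF cdf[OF G(1)] n mult mean[OF G(1)] G(2)]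
        signal_cdf.quantile_of_maximizer[OF cdf[OF Gs(1)] n mult mean[OF Gs(1)] Gs_eq]
      by eventually_elim simp
  qed (use cdf G Gs in auto)
  show ?thesis
    unfolding Gs_def[symmetric] seller_worst_def is_arg_max_def
  proof
    assume "feasible p G \<and> (\<nexists>G'. feasible p G' \<and> V n 0 G < V n 0 G')"
    then have "feasible p G" "(1 - k) * q ^ n - 1 \<le> V n 0 G"
      using Gs Gs_eq by force+
    then show "G = Gs" using le[of G] by (intro unique) auto
  next
    assume "G = Gs"
    then show "feasible p G \<and> (\<nexists>G'. feasible p G' \<and> V n 0 G < V n 0 G')"
      using Gs(1) Gs_eq le by (auto simp: not_less)
  qed
qed

theorem theorem1:
  fixes n :: nat
  assumes "n \<ge> 1"
  shows "\<exists>ks xs :: real \<Rightarrow> real.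
    (\<forall>p\<in>{0<..<1}. ks p \<in> {0..1} \<and> xs p \<in> {0..1} \<and>
       (\<forall>G. seller_worst n p G \<longleftrightarrow> G = trunc_pareto (ks p) (xs p))) \<and>
    (\<exists>p\<^sub>s\<in>{0..1}.
       (\<forall>p\<in>{0<..<1}. (p \<le> p\<^sub>s \<longrightarrow> ks p = 0) \<and> (p > p\<^sub>s \<longrightarrow> ks p > 0)))"
proof -
  obtain ps where ps: "ps \<in> {0..1}" and "\<forall>p\<in>{0<..<1}. \<exists>q k l v. pareto_multipliers n p q k l v \<and>
      (p \<le> ps \<longrightarrow> k = 0) \<and> (p > ps \<longrightarrow> k > 0)"
    using pareto_threshold[OF assms] by blast
  then obtain qs ks ls vs where m: "\<And>p. p \<in> {0<..<1} \<Longrightarrow> pareto_multipliers n p (qs p) (ks p) (ls p) (vs p)"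
      and thr: "\<And>p. p \<in> {0<..<1} \<Longrightarrow> (p \<le> ps \<longrightarrow> ks p = 0) \<and> (p > ps \<longrightarrow> ks p > 0)"
    by metis
  define xs where "xs p = pareto_start (ks p) (qs p)" for p
  have "ks p \<in> {0..1} \<and> xs p \<in> {0..1} \<and> (\<forall>G. seller_worst n p G \<longleftrightarrow> G = trunc_pareto (ks p) (xs p))"
    if p: "p \<in> {0<..<1}" for p
    using seller_worst_iff_pareto[OF assms m[OF p]] pareto_start_bounds[of "ks p" "qs p"] m[OF p]
    by (auto simp: xs_def pareto_multipliers_def)
  with ps thr show ?thesis
    by (intro exI[of _ ks] exI[of _ xs]) blast
qed

end
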